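(* Assume, in addition to the standing assumptions listed in the context, that: (i) $P$ is a convex subset of a real vector space, $0 \in P$, and the partial order on $P$ satisfies $\lambda p_1 + (1-\lambda)p_2 \geq \lambda p_1$ for all $p_1,p_2 \in P$, $\lambda \in [0,1]$; (ii) $U$ is a convex subset of $L^\infty_+(Y)$ for some complete measure space $(Y,\Xi,\eta)$, and $0 \in U$; (iii) $\lambda S(p_1,u_1) + (1-\lambda)S(p_2,u_2) \leq S(\lambda p_1 + (1-\lambda)p_2, \lambda u_1 + (1-\lambda)u_2)$ for all $p_1,p_2 \in P$, $u_1,u_2 \in U$, $\lambda \in [0,1]$; $S(p,u_1) \leq S(p,u_2)$ for all $u_1,u_2 \in U$ with $u_1 \leq u_2$ and all $p \in P$; and $S(p,u) \in L^\infty_+(X)$ for all $p \in P$, $u \in U$; (iv) there exists $\varepsilon>0$ such that $\lambda \Phi(v_1) + (1-\lambda)\Phi(v_2) \leq \Phi(\lambda v_1 + (1-\lambda)v_2)$ for all $\lambda \in [0,1]$ and all $v_1,v_2 \in L^2(X)$ with $v_1 \geq -\varepsilon$ and $v_2 \geq -\varepsilon$. Let $r \in [1,2]$ be an exponent satisfying $S(p,u) \in L^r(X)$ for all $p \in P$, $u \in U$. Denote the unique solution of (F) with parameter $u \in U$ by $\mathbb{S}(u)$ and let $\Psi\colon L^2(X)\times U \to L^2_+(X)$, $\Psi(v,u) := S(\Phi(v),u)$. Then the following holds. (a) The function $\mathbb{S}\colon U \to L^{[r,\infty]}_+(X)$ is Hadamard directionally differentiable on $U \cap L^\infty_\oplus(Y)$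 in the following sense: for every $u \in U \cap L^\infty_\oplus(Y)$ and every $h \in \mathbb{R}^+(U-u)$ there exists a unique $\mathbb{S}'(u;h) \in L^{[r,\infty]}(X)$ such that, for all $\{\tau_n\}\subset(0,\infty)$ and $\{h_n\}\subset \mathbb{R}^+(U-u)$ with $\tau_n \to 0$, $\|h-h_n\|_{L^\infty(Y)}\to 0$ and $u+\tau_n h_n \in U$ for all $n$, the quotients $d_n := (\mathbb{S}(u+\tau_n h_n)-\mathbb{S}(u))/\tau_n$ satisfy $d_n \to \mathbb{S}'(u;h)$ in $L^q(X)$ for all $q \in [r,\infty)$ and $\int_X z\,(d_n - \mathbb{S}'(u;h))\,\mathrm{d}\mu \to 0$ for all $z \in L^1(X)$. (b) The directional derivative $\delta := \mathbb{S}'(u;h)$ at a point $u \in U \cap L^\infty_\oplus(Y)$ in a direction $h \in \mathbb{R}^+(U-u)$ satisfying $u+\tau_0 h \in U$ for a $\tau_0>0$ is characterized by the condition that it is the (necessarily unique) smallest element, w.r.t. the pointwise $\mu$-a.e. partial order on $X$, of the set $\mathscr{A}$ of all $\zeta \in L^{[r,\infty]}(X)$ for which there exist sequences $\{\zeta_n\} \subset L^{[r,\infty]}(X)$ and $\{\tau_n\} \subset (0,\tau_0)$ such that - $\zeta_n \leq \zeta_{n+1}$ and $\tau_{n+1} \leq \tau_n$ for all $n$, - $\tau_n \to 0$ for $n\to\infty$, and $\zeta_n \to \zeta$ in $L^q(X)$ for all $q \in [r,\infty)$, - $\mathbb{S}(u) + \tau_n \zeta_n$ is a supersolution of (F) with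 parameter $u+\tau_n h$ for all $n$, - $\Psi'((\mathbb{S}(u),u);(\zeta_n,h)) - \zeta_n \to 0$ $\mu$-a.e. in $X$ for $n\to\infty$. (c) The set $\mathscr{A}$ is a superset of \[ \mathscr{B} := \left\{ \zeta \in L^{[r,\infty]}(X) \mid \zeta = \Psi'((\mathbb{S}(u),u);(\zeta,h)) \ \mu\text{-a.e. in } X \right\}. \] (d) If $\Psi$ is semicontinuous in the sense that, for every $w \in U$, every $z$ and every sequence $\{z_n\}$ that is bounded in $L^{[r,\infty]}(X)$ and satisfies $z_n \leq z_{n+1}$ for all $n$ and $z_n \to z$ in $L^q(X)$ for all $q \in [r,\infty)$, one has $\limsup_{n\to\infty} \Psi(z_n,w) \geq \Psi(z,w)$ $\mu$-a.e. in $X$, then $\mathscr{A} = \mathscr{B}$ and $\delta = \mathbb{S}'(u;h)$ is the smallest element of $\mathscr{B}$.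
   Context: Standing assumptions and notation. $(X,\Sigma,\mu)$ is a complete measure space. $L^q(X)$ are the usual Lebesgue spaces, ordered by $v_1 \leq v_2 :\iff v_1 \leq v_2$ $\mu$-a.e. in $X$; $L^q_+(X) := \{v \in L^q(X) \mid v \geq 0\}$; $L^{[r,s]}(X) := L^r(X) \cap L^s(X)$ with norm $\|\cdot\|_{L^r(X)}+\|\cdot\|_{L^s(X)}$ for $1 \leq r \leq s \leq \infty$; $L^{[r,s]}_+(X) := L^r_+(X)\cap L^s_+(X)$. $L^0(X,(-\infty,\infty])$ is the set of equivalence classes of measurable functions on $X$ with values in $(-\infty,\infty]$. The same conventions are used for $(Y,\Xi,\eta)$, and $L^\infty_\oplus(Y) := \{v \in L^\infty(Y) \mid v \geq c \text{ a.e. for a constant } c>0\}$. $\bar P$ is a set equipped with a partial order $\leq$, having at least two elements and a largest element $\bar p$; $P := \bar P \setminus \{\bar p\}$. $U$ is a nonempty set. $S\colon \bar P \times U \to L^2_+(X)$ satisfies $S(p_1,u) \leq S(p_2,u)$ for all $u \in U$ and $p_1,p_2 \in \bar P$ with $p_1 \leq p_2$. $\Phi\colon L^2(X) \to P$ satisfies $\Phi(v_1) \leq \Phi(v_2)$ for all $v_1,v_2 \in L^2(X)$ with $v_1 \leq v_2$. $\mathbb{R}^+(U-u) := \{\lambda (w-u) \mid \lambda > 0,\ w \in U\}$. For $u \in U$, problem (F) with parameter $u$ is: find $y \in L^2(X)$ with $y = S(\Phi(y),u)$. An element $v \in L^2(X)$ is a supersolution of (F) with parameter $u$ if $v \geq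 S(\Phi(v),u)$. Under the assumptions (i)–(iv) of the claim, (F) has exactly one solution for each $u\in U$. Directional derivative of $\Psi$: for $(v,u) \in L^2_+(X)\times U$ and $(h_1,h_2) \in L^{[2,\infty]}(X)\times \mathbb{R}^+(U-u)$ with $u+\tau_0 h_2 \in U$ for a $\tau_0>0$, $\Psi'((v,u);(h_1,h_2)) \in L^0(X,(-\infty,\infty])$ denotes the unique function to which $\tau_n^{-1}\left(\Psi(v+\tau_n h_1,u+\tau_n h_2)-\Psi(v,u)\right)$ converges $\mu$-a.e. in $X$ along every sequence $\{\tau_n\}\subset(0,\tau_0)$ with $\tau_n \to 0$ (under the assumptions (i)–(iv) of the claim this function exists). *)

theory Defs
  imports "HOL-Probability.Essential_Supremum"
begin

text \<open>
  Elements of Lebesgue spaces are represented by functions, and equalities and inequalities in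
  these spaces are read almost everywhere. A set of equivalence classes thus corresponds to a set
  of measurable functions that is closed under a.e. equality.
\<close>

abbreviation eq_ae :: "'a measure \<Rightarrow> ('a \<Rightarrow> 'b) \<Rightarrow> ('a \<Rightarrow> 'b) \<Rightarrow> bool" where
  "eq_ae M f g \<equiv> (AE x in M. f x = g x)"

abbreviation le_ae :: "'a measure \<Rightarrow> ('a \<Rightarrow> 'b::ord) \<Rightarrow> ('a \<Rightarrow> 'b) \<Rightarrow> bool" where
  "le_ae M f g \<equiv> (AE x in M. f x \<le> g x)"

definition Lp :: "'a measure \<Rightarrow> real \<Rightarrow> ('a \<Rightarrow> real) set" where
  "Lp M q = {f \<in> borel_measurable M. integrable M (\<lambda>x. \<bar>f x\<bar> powr q)}"

definition Lp_norm :: "'a measure \<Rightarrow> real \<Rightarrow> ('a \<Rightarrow> real) \<Rightarrow> real" where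
  "Lp_norm M q f = (\<integral>x. \<bar>f x\<bar> powr q \<partial>M) powr (1 / q)"

text \<open>With values in \<^typ>\<open>ennreal\<close> the essential supremum is 0, not minus infinity, on null
  spaces.\<close>

definition Linf :: "'a measure \<Rightarrow> ('a \<Rightarrow> real) set" where
  "Linf M = {f \<in> borel_measurable M. esssup M (\<lambda>x. ennreal \<bar>f x\<bar>) < \<infinity>}"

definition Linf_norm :: "'a measure \<Rightarrow> ('a \<Rightarrow> real) \<Rightarrow> real" where
  "Linf_norm M f = enn2real (esssup M (\<lambda>x. ennreal \<bar>f x\<bar>))"

definition Lp_inf :: "'a measure \<Rightarrow> real \<Rightarrow> ('a \<Rightarrow> real) set" where
  "Lp_inf M r = Lp M r \<inter> Linf M"

definition Lp_inf_norm :: "'a measure \<Rightarrow> real \<Rightarrow> ('a \<Rightarrow> real) \<Rightarrow> real" where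
  "Lp_inf_norm M r f = Lp_norm M r f + Linf_norm M f"

definition nonneg_part :: "'a measure \<Rightarrow> ('a \<Rightarrow> real) set \<Rightarrow> ('a \<Rightarrow> real) set" where
  "nonneg_part M V = {f \<in> V. AE x in M. 0 \<le> f x}"

text \<open>The space written \<open>L\<^sup>\<infinity>\<close> with subscript \<open>\<oplus>\<close>: essentially bounded functions that are bounded
  away from zero.\<close>

definition Linf_oplus :: "'a measure \<Rightarrow> ('a \<Rightarrow> real) set" where
  "Linf_oplus M = {f \<in> Linf M. \<exists>c>0. AE x in M. c \<le> f x}"

text \<open>Membership is part of convergence, because \<^const>\<open>Lp_norm\<close> is meaningless (zero) for
  non-integrable functions.\<close>

definition tendsto_Lp ::
  "'a measure \<Rightarrow> real \<Rightarrow> (nat \<Rightarrow> 'a \<Rightarrow> real) \<Rightarrow> ('a \<Rightarrow> real) \<Rightarrow> bool" where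
  "tendsto_Lp M q f g \<longleftrightarrow> (\<forall>n. f n \<in> Lp M q) \<and> g \<in> Lp M q \<and>
     (\<lambda>n. Lp_norm M q (\<lambda>x. f n x - g x)) \<longlonglongrightarrow> 0"

definition tendsto_Linf :: "'a measure \<Rightarrow> (nat \<Rightarrow> 'a \<Rightarrow> real) \<Rightarrow> ('a \<Rightarrow> real) \<Rightarrow> bool" where
  "tendsto_Linf M f g \<longleftrightarrow> (\<forall>n. f n \<in> Linf M) \<and> g \<in> Linf M \<and>
     (\<lambda>n. Linf_norm M (\<lambda>x. f n x - g x)) \<longlonglongrightarrow> 0"

definition smallest_ae :: "'a measure \<Rightarrow> ('a \<Rightarrow> real) set \<Rightarrow> ('a \<Rightarrow> real) \<Rightarrow> bool" where
  "smallest_ae M V d \<longleftrightarrow> d \<in> V \<and> (\<forall>z\<in>V. le_ae M d z)"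

definition cone_at :: "('y \<Rightarrow> real) set \<Rightarrow> ('y \<Rightarrow> real) \<Rightarrow> ('y \<Rightarrow> real) set" where
  "cone_at U u = {h. \<exists>l>0. \<exists>w\<in>U. h = (\<lambda>y. l * (w y - u y))}"

text \<open>
  The set \<open>P\<close> lives in a real vector space, but its added largest element need not.
  Points \<open>p\<close> of \<open>P\<close> are encoded as \<^term>\<open>Some p\<close>, the largest element as \<^const>\<open>None\<close>.
\<close>

definition P_bar :: "'p set \<Rightarrow> 'p option set" where
  "P_bar P = insert None (Some ` P)"

definition Psi ::
  "('p option \<Rightarrow> ('y \<Rightarrow> real) \<Rightarrow> 'x \<Rightarrow> real) \<Rightarrow> (('x \<Rightarrow> real) \<Rightarrow> 'p) \<Rightarrow>
   ('x \<Rightarrow> real) \<Rightarrow> ('y \<Rightarrow> real) \<Rightarrow> 'x \<Rightarrow> real" where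
  "Psi S \<Phi> v u = S (Some (\<Phi> v)) u"

definition is_solution ::
  "'x measure \<Rightarrow> ('p option \<Rightarrow> ('y \<Rightarrow> real) \<Rightarrow> 'x \<Rightarrow> real) \<Rightarrow> (('x \<Rightarrow> real) \<Rightarrow> 'p) \<Rightarrow>
   ('y \<Rightarrow> real) \<Rightarrow> ('x \<Rightarrow> real) \<Rightarrow> bool" where
  "is_solution X S \<Phi> u y \<longleftrightarrow> y \<in> Lp X 2 \<and> eq_ae X y (S (Some (\<Phi> y)) u)"

definition is_supersolution ::
  "'x measure \<Rightarrow> ('p option \<Rightarrow> ('y \<Rightarrow> real) \<Rightarrow> 'x \<Rightarrow> real) \<Rightarrow> (('x \<Rightarrow> real) \<Rightarrow> 'p) \<Rightarrow>
   ('y \<Rightarrow> real) \<Rightarrow> ('x \<Rightarrow> real) \<Rightarrow> bool" where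
  "is_supersolution X S \<Phi> u v \<longleftrightarrow> v \<in> Lp X 2 \<and> le_ae X (S (Some (\<Phi> v)) u) v"

text \<open>A representative of the solution, which is unique only up to null sets.\<close>

definition sol ::
  "'x measure \<Rightarrow> ('p option \<Rightarrow> ('y \<Rightarrow> real) \<Rightarrow> 'x \<Rightarrow> real) \<Rightarrow> (('x \<Rightarrow> real) \<Rightarrow> 'p) \<Rightarrow>
   ('y \<Rightarrow> real) \<Rightarrow> 'x \<Rightarrow> real" where
  "sol X S \<Phi> u = (SOME y. is_solution X S \<Phi> u y)"

definition is_Psi_deriv ::
  "'x measure \<Rightarrow> ('y \<Rightarrow> real) set \<Rightarrow> ('p option \<Rightarrow> ('y \<Rightarrow> real) \<Rightarrow> 'x \<Rightarrow> real) \<Rightarrow>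
   (('x \<Rightarrow> real) \<Rightarrow> 'p) \<Rightarrow> ('x \<Rightarrow> real) \<Rightarrow> ('y \<Rightarrow> real) \<Rightarrow> ('x \<Rightarrow> real) \<Rightarrow> ('y \<Rightarrow> real) \<Rightarrow>
   ('x \<Rightarrow> ereal) \<Rightarrow> bool" where
  "is_Psi_deriv X U S \<Phi> v u h1 h2 D \<longleftrightarrow>
     D \<in> borel_measurable X \<and> (\<forall>x\<in>space X. D x \<noteq> -\<infinity>) \<and>
     (\<forall>\<tau>0>0. (\<lambda>y. u y + \<tau>0 * h2 y) \<in> U \<longrightarrow>
       (\<forall>\<tau>::nat \<Rightarrow> real. (\<forall>n. 0 < \<tau> n \<and> \<tau> n < \<tau>0) \<and> \<tau> \<longlonglongrightarrow> 0 \<longrightarrow>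
         (AE x in X. (\<lambda>n. ereal ((Psi S \<Phi> (\<lambda>x. v x + \<tau> n * h1 x) (\<lambda>y. u y + \<tau> n * h2 y) x
                                    - Psi S \<Phi> v u x) / \<tau> n)) \<longlonglongrightarrow> D x)))"

definition Psi_deriv ::
  "'x measure \<Rightarrow> ('y \<Rightarrow> real) set \<Rightarrow> ('p option \<Rightarrow> ('y \<Rightarrow> real) \<Rightarrow> 'x \<Rightarrow> real) \<Rightarrow>
   (('x \<Rightarrow> real) \<Rightarrow> 'p) \<Rightarrow> ('x \<Rightarrow> real) \<Rightarrow> ('y \<Rightarrow> real) \<Rightarrow> ('x \<Rightarrow> real) \<Rightarrow> ('y \<Rightarrow> real) \<Rightarrow>
   'x \<Rightarrow> ereal" where
  "Psi_deriv X U S \<Phi> v u h1 h2 = (SOME D. is_Psi_deriv X U S \<Phi> v u h1 h2 D)"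

definition is_hadamard_deriv ::
  "'x measure \<Rightarrow> 'y measure \<Rightarrow> ('y \<Rightarrow> real) set \<Rightarrow> real \<Rightarrow> (('y \<Rightarrow> real) \<Rightarrow> 'x \<Rightarrow> real) \<Rightarrow>
   ('y \<Rightarrow> real) \<Rightarrow> ('y \<Rightarrow> real) \<Rightarrow> ('x \<Rightarrow> real) \<Rightarrow> bool" where
  "is_hadamard_deriv X Y U r F u h d \<longleftrightarrow>
     d \<in> Lp_inf X r \<and>
     (\<forall>(\<tau>::nat \<Rightarrow> real) hs dn.
        (\<forall>n. 0 < \<tau> n) \<and> (\<forall>n. hs n \<in> cone_at U u) \<and>
        \<tau> \<longlonglongrightarrow> 0 \<and> tendsto_Linf Y hs h \<and>
        (\<forall>n. (\<lambda>y. u y + \<tau> n * hs n y) \<in> U) \<and>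
        dn = (\<lambda>n x. (F (\<lambda>y. u y + \<tau> n * hs n y) x - F u x) / \<tau> n) \<longrightarrow>
        (\<forall>q\<ge>r. tendsto_Lp X q dn d) \<and>
        (\<forall>z\<in>Lp X 1. (\<lambda>n. \<integral>x. z x * (dn n x - d x) \<partial>X) \<longlonglongrightarrow> 0))"

definition A_set ::
  "'x measure \<Rightarrow> ('y \<Rightarrow> real) set \<Rightarrow> ('p option \<Rightarrow> ('y \<Rightarrow> real) \<Rightarrow> 'x \<Rightarrow> real) \<Rightarrow>
   (('x \<Rightarrow> real) \<Rightarrow> 'p) \<Rightarrow> real \<Rightarrow> ('y \<Rightarrow> real) \<Rightarrow> ('y \<Rightarrow> real) \<Rightarrow> real \<Rightarrow> ('x \<Rightarrow> real) set" where
  "A_set X U S \<Phi> r u h \<tau>0 = {\<zeta> \<in> Lp_inf X r.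
     \<exists>(\<zeta>s :: nat \<Rightarrow> 'x \<Rightarrow> real) (\<tau> :: nat \<Rightarrow> real).
       (\<forall>n. \<zeta>s n \<in> Lp_inf X r) \<and> (\<forall>n. 0 < \<tau> n \<and> \<tau> n < \<tau>0) \<and>
       (\<forall>n. le_ae X (\<zeta>s n) (\<zeta>s (Suc n)) \<and> \<tau> (Suc n) \<le> \<tau> n) \<and>
       \<tau> \<longlonglongrightarrow> 0 \<and> (\<forall>q\<ge>r. tendsto_Lp X q \<zeta>s \<zeta>) \<and>
       (\<forall>n. is_supersolution X S \<Phi> (\<lambda>y. u y + \<tau> n * h y) (\<lambda>x. sol X S \<Phi> u x + \<tau> n * \<zeta>s n x)) \<and>
       (AE x in X. (\<lambda>n. Psi_deriv X U S \<Phi> (sol X S \<Phi> u) u (\<zeta>s n) h x - ereal (\<zeta>s n x)) \<longlonglongrightarrow> 0)}"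

definition B_set ::
  "'x measure \<Rightarrow> ('y \<Rightarrow> real) set \<Rightarrow> ('p option \<Rightarrow> ('y \<Rightarrow> real) \<Rightarrow> 'x \<Rightarrow> real) \<Rightarrow>
   (('x \<Rightarrow> real) \<Rightarrow> 'p) \<Rightarrow> real \<Rightarrow> ('y \<Rightarrow> real) \<Rightarrow> ('y \<Rightarrow> real) \<Rightarrow> ('x \<Rightarrow> real) set" where
  "B_set X U S \<Phi> r u h = {\<zeta> \<in> Lp_inf X r.
     AE x in X. ereal (\<zeta> x) = Psi_deriv X U S \<Phi> (sol X S \<Phi> u) u \<zeta> h x}"

definition Psi_semicontinuous ::
  "'x measure \<Rightarrow> ('y \<Rightarrow> real) set \<Rightarrow> ('p option \<Rightarrow> ('y \<Rightarrow> real) \<Rightarrow> 'x \<Rightarrow> real) \<Rightarrow>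
   (('x \<Rightarrow> real) \<Rightarrow> 'p) \<Rightarrow> real \<Rightarrow> bool" where
  "Psi_semicontinuous X U S \<Phi> r \<longleftrightarrow>
     (\<forall>w\<in>U. \<forall>z zs.
        (\<forall>n. zs n \<in> Lp_inf X r) \<and> (\<exists>C. \<forall>n. Lp_inf_norm X r (zs n) \<le> C) \<and>
        (\<forall>n. le_ae X (zs n) (zs (Suc n))) \<and> (\<forall>q\<ge>r. tendsto_Lp X q zs z) \<longrightarrow>
        (AE x in X. limsup (\<lambda>n. ereal (Psi S \<Phi> (zs n) w x)) \<ge> ereal (Psi S \<Phi> z w x)))"

end

theory Submission
  imports Defs
begin

text \<open>
  Write \<open>T(v, u) = S(\<Phi>(v), u)\<close> and let \<open>y(u)\<close> be the solution with parameter \<open>u\<close>. Everything rests on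
  the fact that \<open>T\<close> is increasing and jointly concave where \<open>v \<ge> - \<epsilon>\<close>, with nonnegative bounded values.

  Concavity slightly below zero makes \<open>T\<close> a contraction in the sense of the order: if \<open>0 \<le> v \<le> M\<close>,
  then \<open>T((1 - \<theta>) v, u) \<ge> (1 - b \<theta>) T(v, u)\<close> with \<open>b = M / (M + \<epsilon>) < 1\<close> (\<open>T_amplifies\<close>). Iterating this gives
  a comparison principle, namely that every subsolution lies below every supersolution
  (\<open>subsolution_le_supersolution\<close>), and hence uniqueness; applied to the decreasing iterates that start
  at the upper bound of the range, it replaces continuity in the proof of existence
  (\<open>solution_exists\<close>).

  By comparison, \<open>u \<mapsto> y(u)\<close> is itself increasing and concave, with \<open>y(0) \<ge> 0\<close>. If \<open>u \<ge> c > 0\<close>, this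
  forces the pointwise Lipschitz estimate \<open>\<bar>y(w) - y(u)\<bar> \<le> (\<parallel>w - u\<parallel> / c) y(u)\<close> (\<open>sol_lipschitz\<close>). So the
  difference quotients in a fixed direction increase as the step decreases, they are dominated by a
  multiple of \<open>y(u)\<close>, and they converge almost everywhere. The Lipschitz estimate allows for varying directions, and
  dominated convergence, with the dominating function \<open>y(u)\<close> in all \<open>L\<^sup>q\<close> with \<open>q \<ge> r\<close> and in \<open>L\<^sup>\<infinity>\<close>, gives Hadamard
  differentiability (\<open>quotient_limit_imp_hadamard\<close>).

  For small steps the quotients of \<open>T\<close> increase as well when the step decreases, so their limit
  \<open>\<Psi>'\<close> is also their supremum. Let \<open>\<delta>\<close> be the derivative of the solution map and \<open>\<zeta>\<^sub>n\<close> a difference quotient of it. From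
  \<open>\<zeta>\<^sub>n \<le> \<Psi>'(\<zeta>\<^sub>n) \<le> \<delta>\<close> one reads off \<open>\<delta> \<in> \<A>\<close> (\<open>quotient_limit_in_A_set\<close>), and comparison with
  supersolutions shows that \<open>\<delta>\<close> lies below every element of \<open>\<A>\<close> (\<open>quotient_limit_le_A_set\<close>). An element \<open>\<zeta>\<close> of
  \<open>\<B>\<close> satisfies \<open>\<Psi>'(\<zeta>) = \<zeta>\<close>, so it bounds the quotients of \<open>T\<close> in its own direction, which is the
  supersolution property (\<open>B_set_subset_A_set\<close>). Semicontinuity permits passing to the limit in the
  direction at a fixed step, which yields the reverse inclusion (\<open>A_set_subset_B_set\<close>).
\<close>

section \<open>Lebesgue spaces of representatives\<close>

lemma Lp_measurable: "f \<in> Lp M q \<Longrightarrow> f \<in> borel_measurable M"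
  by (simp add: Lp_def)

lemma Lp_dominated:
  assumes g: "g \<in> Lp M q" and f: "f \<in> borel_measurable M" and q: "0 \<le> q"
    and le: "AE x in M. \<bar>f x\<bar> \<le> \<bar>g x\<bar>"
  shows "f \<in> Lp M q"
proof -
  have "integrable M (\<lambda>x. \<bar>f x\<bar> powr q)"
  proof (rule Bochner_Integration.integrable_bound)
    show "integrable M (\<lambda>x. \<bar>g x\<bar> powr q)" using g by (simp add: Lp_def)
    show "(\<lambda>x. \<bar>f x\<bar> powr q) \<in> borel_measurable M" using f by measurable
    show "AE x in M. norm (\<bar>f x\<bar> powr q) \<le> norm (\<bar>g x\<bar> powr q)"
      using le by eventually_elim (auto intro!: powr_mono2 q)
  qed
  then show ?thesis using f by (simp add: Lp_def)
qed

lemma Lp_scale: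
  assumes "f \<in> Lp M q"
  shows "(\<lambda>x. c * f x) \<in> Lp M q"
  using assms by (auto simp: Lp_def abs_mult powr_mult)

lemma Lp_add:
  assumes f: "f \<in> Lp M q" and g: "g \<in> Lp M q" and q: "0 \<le> q"
  shows "(\<lambda>x. f x + g x) \<in> Lp M q"
proof -
  have fg[measurable]: "f \<in> borel_measurable M" "g \<in> borel_measurable M"
    using f g by (auto simp: Lp_def)
  have "integrable M (\<lambda>x. \<bar>f x + g x\<bar> powr q)"
  proof (rule Bochner_Integration.integrable_bound)
    show "integrable M (\<lambda>x. 2 powr q * (\<bar>f x\<bar> powr q + \<bar>g x\<bar> powr q))"
      using f g by (simp add: Lp_def)
    have "\<bar>f x + g x\<bar> powr q \<le> 2 powr q * (\<bar>f x\<bar> powr q + \<bar>g x\<bar> powr q)" for x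
    proof -
      have "\<bar>f x + g x\<bar> powr q \<le> (2 * max \<bar>f x\<bar> \<bar>g x\<bar>) powr q"
        by (rule powr_mono2) (auto simp: q)
      also have "\<dots> = 2 powr q * max \<bar>f x\<bar> \<bar>g x\<bar> powr q" by (simp add: powr_mult)
      also have "\<dots> \<le> 2 powr q * (\<bar>f x\<bar> powr q + \<bar>g x\<bar> powr q)"
        by (auto simp: max_def)
      finally show ?thesis .
    qed
    then show "AE x in M. norm (\<bar>f x + g x\<bar> powr q)
        \<le> norm (2 powr q * (\<bar>f x\<bar> powr q + \<bar>g x\<bar> powr q))"
      by (intro AE_I2) auto
  qed measurable
  then show ?thesis by (simp add: Lp_def)
qed

lemma Lp_lincomb:
  assumes "f \<in> Lp M q" "g \<in> Lp M q" "0 \<le> q"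
  shows "(\<lambda>x. a * f x + b * g x) \<in> Lp M q"
  using Lp_add[OF Lp_scale Lp_scale] assms by blast

lemma mem_Linf_iff: "f \<in> Linf M \<longleftrightarrow> f \<in> borel_measurable M \<and> (\<exists>C\<ge>0. AE x in M. \<bar>f x\<bar> \<le> C)"
proof (cases "f \<in> borel_measurable M")
  case True
  then have [measurable]: "f \<in> borel_measurable M" .
  have meas: "(\<lambda>x. ennreal \<bar>f x\<bar>) \<in> borel_measurable M" by measurable
  have "\<exists>C\<ge>0. AE x in M. \<bar>f x\<bar> \<le> C" if "esssup M (\<lambda>x. ennreal \<bar>f x\<bar>) < \<infinity>"
  proof (intro exI conjI)
    show "AE x in M. \<bar>f x\<bar> \<le> enn2real (esssup M (\<lambda>x. ennreal \<bar>f x\<bar>))"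
      using esssup_AE[of "\<lambda>x. ennreal \<bar>f x\<bar>" M]
    proof eventually_elim
      case (elim x)
      then have "enn2real (ennreal \<bar>f x\<bar>) \<le> enn2real (esssup M (\<lambda>x. ennreal \<bar>f x\<bar>))"
        using that by (intro enn2real_mono) auto
      then show ?case by simp
    qed
  qed simp
  moreover have "esssup M (\<lambda>x. ennreal \<bar>f x\<bar>) < \<infinity>" if "AE x in M. \<bar>f x\<bar> \<le> C" for C
  proof -
    have "esssup M (\<lambda>x. ennreal \<bar>f x\<bar>) \<le> ennreal C"
      using that by (intro esssup_I meas) (auto intro: ennreal_leI)
    also have "\<dots> < \<infinity>" by simp
    finally show ?thesis .
  qed
  ultimately show ?thesis using True by (auto simp: Linf_def)
qed (auto simp: Linf_def)

lemma AE_le_Linf_norm: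
  assumes "f \<in> Linf M"
  shows "AE x in M. \<bar>f x\<bar> \<le> Linf_norm M f"
  using esssup_AE[of "\<lambda>x. ennreal \<bar>f x\<bar>" M]
proof eventually_elim
  case (elim x)
  then have "enn2real (ennreal \<bar>f x\<bar>) \<le> enn2real (esssup M (\<lambda>x. ennreal \<bar>f x\<bar>))"
    using assms by (intro enn2real_mono) (auto simp: Linf_def)
  then show ?case by (simp add: Linf_norm_def)
qed

lemma Linf_norm_nonneg: "0 \<le> Linf_norm M f"
  by (simp add: Linf_norm_def)

lemma Linf_norm_le:
  assumes f: "f \<in> borel_measurable M" and C: "0 \<le> C" "AE x in M. \<bar>f x\<bar> \<le> C"
  shows "Linf_norm M f \<le> C"
proof -
  have "esssup M (\<lambda>x. ennreal \<bar>f x\<bar>) \<le> ennreal C"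
  proof (rule esssup_I)
    show "(\<lambda>x. ennreal \<bar>f x\<bar>) \<in> borel_measurable M" using f by measurable
    show "AE x in M. ennreal \<bar>f x\<bar> \<le> ennreal C" using C(2) by (auto intro: ennreal_leI)
  qed
  then have "enn2real (esssup M (\<lambda>x. ennreal \<bar>f x\<bar>)) \<le> enn2real (ennreal C)"
    by (intro enn2real_mono) auto
  then show ?thesis using C by (simp add: Linf_norm_def)
qed

lemma Linf_dominated:
  assumes "g \<in> Linf M" "f \<in> borel_measurable M" "AE x in M. \<bar>f x\<bar> \<le> \<bar>g x\<bar>"
  shows "f \<in> Linf M"
  using assms unfolding mem_Linf_iff by (auto intro: AE_mp order_trans elim!: AE_mp)

lemma Linf_lincomb:
  assumes f: "f \<in> Linf M" and g: "g \<in> Linf M"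
  shows "(\<lambda>x. a * f x + b * g x) \<in> Linf M"
proof -
  obtain C D where CD: "AE x in M. \<bar>f x\<bar> \<le> C" "AE x in M. \<bar>g x\<bar> \<le> D" "0 \<le> C" "0 \<le> D"
    using f g unfolding mem_Linf_iff by blast
  have "AE x in M. \<bar>a * f x + b * g x\<bar> \<le> \<bar>a\<bar> * C + \<bar>b\<bar> * D"
    using CD(1,2)
  proof eventually_elim
    case (elim x)
    have "\<bar>a * f x + b * g x\<bar> \<le> \<bar>a\<bar> * \<bar>f x\<bar> + \<bar>b\<bar> * \<bar>g x\<bar>"
      by (simp add: abs_mult[symmetric] abs_triangle_ineq)
    also have "\<dots> \<le> \<bar>a\<bar> * C + \<bar>b\<bar> * D"
      using elim by (intro add_mono mult_left_mono) auto
    finally show ?case .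
  qed
  moreover have "0 \<le> \<bar>a\<bar> * C + \<bar>b\<bar> * D" using CD by simp
  moreover have "(\<lambda>x. a * f x + b * g x) \<in> borel_measurable M"
    using f g unfolding mem_Linf_iff by auto
  ultimately show ?thesis unfolding mem_Linf_iff by blast
qed

lemma Lp_inf_measurable: "f \<in> Lp_inf M q \<Longrightarrow> f \<in> borel_measurable M"
  by (simp add: Lp_inf_def Lp_def)

lemma Lp_inf_dominated:
  assumes "g \<in> Lp_inf M q" "f \<in> borel_measurable M" "0 \<le> q" "AE x in M. \<bar>f x\<bar> \<le> \<bar>g x\<bar>"
  shows "f \<in> Lp_inf M q"
  using assms Lp_dominated Linf_dominated unfolding Lp_inf_def by blast

lemma Lp_inf_lincomb:
  assumes "f \<in> Lp_inf M q" "g \<in> Lp_inf M q" "0 \<le> q"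
  shows "(\<lambda>x. a * f x + b * g x) \<in> Lp_inf M q"
  using assms Lp_lincomb Linf_lincomb unfolding Lp_inf_def by blast

lemma Lp_inf_bounded:
  assumes "f \<in> Lp_inf M q"
  obtains C where "0 < C" "AE x in M. \<bar>f x\<bar> \<le> C"
proof -
  obtain C where C: "0 \<le> C" "AE x in M. \<bar>f x\<bar> \<le> C"
    using assms by (auto simp: Lp_inf_def mem_Linf_iff)
  show thesis
  proof
    show "0 < C + 1" using C by simp
    show "AE x in M. \<bar>f x\<bar> \<le> C + 1" using C(2) by eventually_elim simp
  qed
qed

text \<open>On bounded functions a higher power is controlled by a lower one, so boundedness makes the
  scale of spaces decreasing in the exponent even if the measure is infinite.\<close>

lemma Lp_inf_imp_Lp:
  assumes f: "f \<in> Lp_inf M r" and q: "r \<le> q"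
  shows "f \<in> Lp M q"
proof -
  have [measurable]: "f \<in> borel_measurable M" using f by (rule Lp_inf_measurable)
  obtain C where C: "0 < C" "AE x in M. \<bar>f x\<bar> \<le> C" using f by (rule Lp_inf_bounded)
  have "integrable M (\<lambda>x. \<bar>f x\<bar> powr q)"
  proof (rule Bochner_Integration.integrable_bound)
    show "integrable M (\<lambda>x. C powr (q - r) * \<bar>f x\<bar> powr r)"
      using f by (simp add: Lp_inf_def Lp_def)
    show "AE x in M. norm (\<bar>f x\<bar> powr q) \<le> norm (C powr (q - r) * \<bar>f x\<bar> powr r)"
      using C(2)
    proof eventually_elim
      case (elim x)
      have "\<bar>f x\<bar> powr q = \<bar>f x\<bar> powr (q - r) * \<bar>f x\<bar> powr r"
        by (simp flip: powr_add)
      also have "\<dots> \<le> C powr (q - r) * \<bar>f x\<bar> powr r"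
        using elim q by (intro mult_right_mono powr_mono2) auto
      finally show ?case by simp
    qed
  qed measurable
  then show ?thesis by (simp add: Lp_def)
qed

lemma Lp_inf_mono: "r \<le> q \<Longrightarrow> Lp_inf M r \<subseteq> Lp_inf M q"
  using Lp_inf_imp_Lp by (auto simp: Lp_inf_def)

lemma Lp_norm_mono:
  assumes g: "g \<in> Lp M q" and f: "f \<in> borel_measurable M" and q: "0 < q"
    and le: "AE x in M. \<bar>f x\<bar> \<le> \<bar>g x\<bar>"
  shows "Lp_norm M q f \<le> Lp_norm M q g"
  unfolding Lp_norm_def
proof (rule powr_mono2)
  have "f \<in> Lp M q" using Lp_dominated[OF g f _ le] q by simp
  then show "(\<integral>x. \<bar>f x\<bar> powr q \<partial>M) \<le> (\<integral>x. \<bar>g x\<bar> powr q \<partial>M)"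
    using g le q by (intro integral_mono_AE) (auto simp: Lp_def intro!: powr_mono2 elim!: AE_mp)
qed (use q in auto)

lemma AE_limit_bound:
  fixes f :: "nat \<Rightarrow> 'a \<Rightarrow> real"
  assumes "\<And>n. AE x in M. \<bar>f n x\<bar> \<le> G x" "AE x in M. (\<lambda>n. f n x) \<longlonglongrightarrow> g x"
  shows "AE x in M. \<bar>g x\<bar> \<le> G x"
proof -
  have "AE x in M. \<forall>n. \<bar>f n x\<bar> \<le> G x" using assms(1) by (simp add: AE_all_countable)
  then show ?thesis using assms(2)
  proof eventually_elim
    case (elim x)
    show ?case by (rule LIMSEQ_le_const2[OF tendsto_rabs[OF elim(2)]]) (use elim(1) in auto)
  qed
qed

text \<open>The form in which the geometric estimates of the comparison principle are exploited.\<close>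

lemma AE_le_of_geometric:
  fixes f g :: "'a \<Rightarrow> real"
  assumes b: "0 \<le> b" "b < (1::real)" and le: "\<And>n::nat. AE x in M. (1 - b ^ n) * f x \<le> g x"
  shows "le_ae M f g"
proof -
  have lim: "(\<lambda>n. (1 - b ^ n) * a) \<longlonglongrightarrow> (1 - 0) * a" for a
    using b by (intro tendsto_intros LIMSEQ_power_zero) auto
  have "AE x in M. \<forall>n. (1 - b ^ n) * f x \<le> g x" using le by (simp add: AE_all_countable)
  then show ?thesis
  proof eventually_elim
    case (elim x)
    then show ?case using LIMSEQ_le_const2[OF lim[of "f x"]] by simp
  qed
qed

lemma tendsto_Lp_dominated:
  assumes q: "0 < q" and f: "\<And>n. f n \<in> borel_measurable M" and g: "g \<in> borel_measurable M"
    and G: "G \<in> Lp M q" and bound: "\<And>n. AE x in M. \<bar>f n x\<bar> \<le> G x"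
    and lim: "AE x in M. (\<lambda>n. f n x) \<longlonglongrightarrow> g x"
  shows "tendsto_Lp M q f g"
proof -
  have [measurable]: "\<And>n. f n \<in> borel_measurable M" "g \<in> borel_measurable M"
    "G \<in> borel_measurable M" using f g G by (auto simp: Lp_def)
  have gG: "AE x in M. \<bar>g x\<bar> \<le> G x" by (rule AE_limit_bound[OF bound lim])
  have fLp: "f n \<in> Lp M q" for n
    by (rule Lp_dominated[OF G]) (use q bound[of n] in \<open>auto elim!: AE_mp\<close>)
  have gLp: "g \<in> Lp M q"
    by (rule Lp_dominated[OF G]) (use q gG in \<open>auto elim!: AE_mp\<close>)
  have "(\<lambda>n. \<integral>x. \<bar>f n x - g x\<bar> powr q \<partial>M) \<longlonglongrightarrow> (\<integral>x. 0 \<partial>M)"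
  proof (rule integral_dominated_convergence)
    show "integrable M (\<lambda>x. \<bar>2 * G x\<bar> powr q)"
      using Lp_scale[OF G, of 2] by (simp add: Lp_def)
    show "AE x in M. (\<lambda>n. \<bar>f n x - g x\<bar> powr q) \<longlonglongrightarrow> 0"
      using lim
    proof eventually_elim
      case (elim x)
      then have "(\<lambda>n. \<bar>f n x - g x\<bar>) \<longlonglongrightarrow> 0"
        by (simp add: LIM_zero tendsto_rabs_zero)
      then show ?case using q by (intro tendsto_zero_powrI[of _ _ _ q]) auto
    qed
    show "AE x in M. norm (\<bar>f n x - g x\<bar> powr q) \<le> \<bar>2 * G x\<bar> powr q" for n
      using bound[of n] gG
    proof eventually_elim
      case (elim x)
      then have "\<bar>f n x - g x\<bar> \<le> \<bar>2 * G x\<bar>" by linarith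
      then show ?case using q by (auto intro!: powr_mono2)
    qed
  qed auto
  then have "(\<lambda>n. Lp_norm M q (\<lambda>x. f n x - g x)) \<longlonglongrightarrow> 0"
    unfolding Lp_norm_def using q by (intro tendsto_zero_powrI[of _ _ _ "1/q"]) auto
  then show ?thesis using fLp gLp by (simp add: tendsto_Lp_def)
qed

text \<open>Convergence in the mean identifies the limit pointwise, but only along a subsequence. The two
consequences below remove the subsequence: when an a.e. limit is already known, and when the
sequence is monotone.\<close>

lemma tendsto_Lp_AE_subseq:
  assumes q: "0 < q" and lim: "tendsto_Lp M q f g"
  obtains s where "strict_mono s" "AE x in M. (\<lambda>n. f (s n) x) \<longlonglongrightarrow> g x"
proof -
  have fg: "\<And>n. f n \<in> Lp M q" "g \<in> Lp M q"
    and norm0: "(\<lambda>n. Lp_norm M q (\<lambda>x. f n x - g x)) \<longlonglongrightarrow> 0"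
    using lim by (auto simp: tendsto_Lp_def)
  have diff: "(\<lambda>x. f n x - g x) \<in> Lp M q" for n
    using Lp_lincomb[OF fg(1)[of n] fg(2), of 1 "-1"] q by simp
  have "(\<lambda>n. Lp_norm M q (\<lambda>x. f n x - g x) powr q) \<longlonglongrightarrow> 0"
    using q norm0 by (intro tendsto_zero_powrI[of _ _ _ q]) (auto simp: Lp_norm_def)
  moreover have "Lp_norm M q (\<lambda>x. f n x - g x) powr q = (\<integral>x. norm (\<bar>f n x - g x\<bar> powr q) \<partial>M)" for n
    using q by (simp add: Lp_norm_def powr_powr)
  ultimately have "(\<lambda>n. \<integral>x. norm (\<bar>f n x - g x\<bar> powr q) \<partial>M) \<longlonglongrightarrow> 0" by simp
  moreover have "integrable M (\<lambda>x. \<bar>f n x - g x\<bar> powr q)" for n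
    using diff by (simp add: Lp_def)
  ultimately obtain s :: "nat \<Rightarrow> nat" where s: "strict_mono s"
    "AE x in M. (\<lambda>n. \<bar>f (s n) x - g x\<bar> powr q) \<longlonglongrightarrow> 0"
    using tendsto_L1_AE_subseq[of M "\<lambda>n x. \<bar>f n x - g x\<bar> powr q"] by auto
  have "AE x in M. (\<lambda>n. f (s n) x) \<longlonglongrightarrow> g x"
    using s(2)
  proof eventually_elim
    case (elim x)
    then have "(\<lambda>n. (\<bar>f (s n) x - g x\<bar> powr q) powr (1/q)) \<longlonglongrightarrow> 0"
      by (rule tendsto_zero_powrI[OF _ tendsto_const]) (use q in auto)
    then have "(\<lambda>n. \<bar>f (s n) x - g x\<bar>) \<longlonglongrightarrow> 0" using q by (simp add: powr_powr)
    then show ?case by (simp add: LIM_zero_cancel tendsto_rabs_zero_iff)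
  qed
  then show thesis using s(1) that by blast
qed

lemma tendsto_Lp_limit_unique:
  assumes q: "0 < q" and f: "tendsto_Lp M q f g" "AE x in M. (\<lambda>n. f n x) \<longlonglongrightarrow> g' x"
  shows "eq_ae M g g'"
proof -
  obtain s where s: "strict_mono s" "AE x in M. (\<lambda>n. f (s n) x) \<longlonglongrightarrow> g x"
    using tendsto_Lp_AE_subseq[OF q f(1)] by blast
  show ?thesis using s(2) f(2)
  proof eventually_elim
    case (elim x)
    then show ?case
      using LIMSEQ_subseq_LIMSEQ[OF elim(2) s(1)] LIMSEQ_unique[of "\<lambda>n. f (s n) x"]
      by (auto simp: o_def)
  qed
qed

lemma tendsto_Lp_incseq_AE:
  assumes q: "0 < q" and f: "tendsto_Lp M q f g" and mono: "\<And>n. le_ae M (f n) (f (Suc n))"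
  shows "AE x in M. incseq (\<lambda>n. f n x) \<and> (\<lambda>n. f n x) \<longlonglongrightarrow> g x"
proof -
  obtain s where s: "strict_mono s" "AE x in M. (\<lambda>n. f (s n) x) \<longlonglongrightarrow> g x"
    using tendsto_Lp_AE_subseq[OF q f] by blast
  have "AE x in M. \<forall>n. f n x \<le> f (Suc n) x" using mono by (simp add: AE_all_countable)
  then show ?thesis using s(2)
  proof eventually_elim
    case (elim x)
    then have inc: "incseq (\<lambda>n. f n x)" by (simp add: incseq_SucI)
    have "f n x \<le> g x" for n
    proof (rule LIMSEQ_le_const[OF elim(2)], intro exI allI impI)
      fix m assume "n \<le> m"
      then have "n \<le> s m" using s(1) seq_suble order_trans by blast
      then show "f n x \<le> f (s m) x" using inc by (auto dest: incseqD)
    qed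
    then obtain L where L: "(\<lambda>n. f n x) \<longlonglongrightarrow> L"
      using incseq_convergent[OF inc, of "g x"] by blast
    then have "L = g x"
      using LIMSEQ_unique[OF LIMSEQ_subseq_LIMSEQ[OF L s(1)]] elim(2) by (simp add: o_def)
    then show ?case using inc L by simp
  qed
qed

lemma tendsto_Lp_cong_limit:
  assumes "tendsto_Lp M q f g" "eq_ae M g g'" "g' \<in> Lp M q"
  shows "tendsto_Lp M q f g'"
proof -
  have [measurable]: "\<And>n. f n \<in> borel_measurable M" "g \<in> borel_measurable M"
    "g' \<in> borel_measurable M" using assms by (auto simp: tendsto_Lp_def Lp_def)
  have "Lp_norm M q (\<lambda>x. f n x - g x) = Lp_norm M q (\<lambda>x. f n x - g' x)" for n
    unfolding Lp_norm_def using assms(2)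
    by (intro arg_cong[where f="\<lambda>t. t powr (1/q)"] integral_cong_AE) (auto elim!: AE_mp)
  then show ?thesis using assms(1,3) by (simp add: tendsto_Lp_def)
qed

text \<open>A uniform bound on the sequence makes \<open>C \<bar>z\<bar>\<close> a dominating function for each integrable test
function \<open>z\<close>, so this convergence follows without any duality theory.\<close>

lemma weak_star_dominated:
  fixes f :: "nat \<Rightarrow> 'a \<Rightarrow> real"
  assumes z: "z \<in> Lp M 1" and f: "\<And>n. f n \<in> borel_measurable M"
    and bound: "\<And>n. AE x in M. \<bar>f n x\<bar> \<le> C"
    and lim: "AE x in M. (\<lambda>n. f n x) \<longlonglongrightarrow> 0"
  shows "(\<lambda>n. \<integral>x. z x * f n x \<partial>M) \<longlonglongrightarrow> 0"
proof -
  have [measurable]: "z \<in> borel_measurable M" "\<And>n. f n \<in> borel_measurable M"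
    using z f by (auto simp: Lp_def)
  have "(\<lambda>n. \<integral>x. z x * f n x \<partial>M) \<longlonglongrightarrow> (\<integral>x. 0 \<partial>M)"
  proof (rule integral_dominated_convergence)
    show "integrable M (\<lambda>x. \<bar>z x\<bar> * C)" using z by (simp add: Lp_def)
    show "AE x in M. (\<lambda>n. z x * f n x) \<longlonglongrightarrow> 0"
      using lim by eventually_elim (simp add: tendsto_mult_right_zero)
    show "AE x in M. norm (z x * f n x) \<le> \<bar>z x\<bar> * C" for n
      using bound[of n] by eventually_elim (simp add: abs_mult mult_left_mono)
  qed auto
  then show ?thesis by simp
qed

section \<open>Difference quotients that increase as the step size decreases\<close>

lemma null_steps:
  assumes "0 < (t::real)"
  shows "0 < t / real (Suc (Suc n))" "t / real (Suc (Suc n)) < t"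
    "(\<lambda>n. t / real (Suc (Suc n))) \<longlonglongrightarrow> 0"
    "m \<le> n \<Longrightarrow> t / real (Suc (Suc n)) \<le> t / real (Suc (Suc m))"
  using assms LIMSEQ_Suc[OF LIMSEQ_Suc[OF lim_const_over_n[of t]]]
  by (auto simp: field_simps add_pos_nonneg)

text \<open>For a concave curve with values \<open>a\<close>, \<open>c\<close>, \<open>b\<close> at \<open>0\<close>, \<open>s\<close>, \<open>t\<close>, the chord inequality at \<open>s\<close> says
that the slope of the chord from \<open>0\<close> can only grow when the step is shortened.\<close>

lemma concave_quotient_antitone:
  fixes a b c s t :: real
  assumes "0 < s" "s \<le> t" "(s / t) * b + (1 - s / t) * a \<le> c"
  shows "(b - a) / t \<le> (c - a) / s"
proof -
  have "s * ((b - a) / t) \<le> c - a" using assms by (simp add: field_simps)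
  then show ?thesis using assms by (simp add: field_simps)
qed

text \<open>Monotonicity in the step is known only up to a null set that depends on the pair of steps. A
supremum over all steps would involve uncountably many null sets, so the limit is defined by the
steps \<open>t1 / (k + 1)\<close>. An arbitrary null sequence is interlaced with these countably many steps, and
therefore has the same limit. For the same reason the exceptional set may depend on the sequence.\<close>

lemma antitone_quotient_limit:
  fixes Q :: "real \<Rightarrow> 'a \<Rightarrow> real"
  assumes t1: "0 < t1"
    and anti: "\<And>s t. 0 < s \<Longrightarrow> s \<le> t \<Longrightarrow> t \<le> t1 \<Longrightarrow> AE x in M. Q t x \<le> Q s x"
    and pos: "\<And>n. 0 < \<tau> n" and lim: "\<tau> \<longlonglongrightarrow> 0"
  shows "AE x in M. (\<lambda>n. ereal (Q (\<tau> n) x)) \<longlonglongrightarrow> (SUP k. ereal (Q (t1 / real (Suc k)) x))"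
proof -
  have t: "0 < t1 / real (Suc k)" "t1 / real (Suc k) \<le> t1" for k
    using t1 by (auto simp: field_simps)
  have "AE x in M. \<forall>n k. \<tau> n \<le> t1 / real (Suc k) \<longrightarrow> Q (t1 / real (Suc k)) x \<le> Q (\<tau> n) x"
    unfolding AE_all_countable using anti[OF pos] t by auto
  moreover have "AE x in M. \<forall>n k. t1 / real (Suc k) \<le> \<tau> n \<and> \<tau> n \<le> t1 \<longrightarrow>
      Q (\<tau> n) x \<le> Q (t1 / real (Suc k)) x"
    unfolding AE_all_countable using anti[OF t(1)] by auto
  ultimately show ?thesis
  proof eventually_elim
    case (elim x)
    let ?D = "SUP k. ereal (Q (t1 / real (Suc k)) x)"
    show ?case
    proof (rule order_tendstoI)
      fix a assume "a < ?D"
      then obtain k where k: "a < ereal (Q (t1 / real (Suc k)) x)" by (auto simp: less_SUP_iff)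
      have "\<forall>\<^sub>F n in sequentially. \<tau> n < t1 / real (Suc k)"
        using order_tendstoD(2)[OF lim t(1)] .
      then show "\<forall>\<^sub>F n in sequentially. a < ereal (Q (\<tau> n) x)"
      proof eventually_elim
        case (elim n)
        then have "ereal (Q (t1 / real (Suc k)) x) \<le> ereal (Q (\<tau> n) x)"
          using \<open>\<forall>n k. \<tau> n \<le> t1 / real (Suc k) \<longrightarrow> _ n k\<close> by simp
        then show ?case using k by (rule order_less_le_trans[rotated])
      qed
    next
      fix a assume a: "?D < a"
      have "\<forall>\<^sub>F n in sequentially. \<tau> n < t1"
        using order_tendstoD(2)[OF lim t1] .
      then show "\<forall>\<^sub>F n in sequentially. ereal (Q (\<tau> n) x) < a"
      proof eventually_elim
        case (elim n)
        obtain k where "t1 / \<tau> n < real k" using reals_Archimedean2 by blast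
        then have "t1 / real (Suc k) \<le> \<tau> n" using pos[of n] t1 by (simp add: field_simps)
        then have "ereal (Q (\<tau> n) x) \<le> ereal (Q (t1 / real (Suc k)) x)"
          using \<open>\<forall>n k. t1 / real (Suc k) \<le> \<tau> n \<and> \<tau> n \<le> t1 \<longrightarrow> _ n k\<close> elim by simp
        also have "\<dots> \<le> ?D" by (rule SUP_upper) simp
        also note a
        finally show ?case .
      qed
    qed
  qed
qed

text \<open>With a pointwise bound the supremum is finite, and there is a real-valued measurable limit.\<close>

lemma bounded_antitone_quotient_limit:
  fixes Q :: "real \<Rightarrow> 'a \<Rightarrow> real"
  assumes t1: "0 < t1"
    and anti: "\<And>s t. 0 < s \<Longrightarrow> s \<le> t \<Longrightarrow> t \<le> t1 \<Longrightarrow> AE x in M. Q t x \<le> Q s x"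
    and meas: "\<And>t. 0 < t \<Longrightarrow> t \<le> t1 \<Longrightarrow> Q t \<in> borel_measurable M"
    and bound: "\<And>t. 0 < t \<Longrightarrow> t \<le> t1 \<Longrightarrow> AE x in M. \<bar>Q t x\<bar> \<le> G x"
  shows "\<exists>D. D \<in> borel_measurable M \<and> (\<forall>\<tau>::nat \<Rightarrow> real. (\<forall>n. 0 < \<tau> n) \<and> \<tau> \<longlonglongrightarrow> 0 \<longrightarrow>
    (AE x in M. (\<lambda>n. Q (\<tau> n) x) \<longlonglongrightarrow> D x))"
proof (intro exI conjI allI impI)
  let ?S = "\<lambda>x. SUP k. ereal (Q (t1 / real (Suc k)) x)"
  have t: "0 < t1 / real (Suc k)" "t1 / real (Suc k) \<le> t1" for k
    using t1 by (auto simp: field_simps)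
  have [measurable]: "Q (t1 / real (Suc k)) \<in> borel_measurable M" for k
    by (rule meas[OF t])
  show "(\<lambda>x. real_of_ereal (?S x)) \<in> borel_measurable M" by measurable
  have "AE x in M. \<forall>k. \<bar>Q (t1 / real (Suc k)) x\<bar> \<le> G x"
    unfolding AE_all_countable using bound[OF t] by blast
  then have fin: "AE x in M. \<bar>?S x\<bar> \<noteq> \<infinity>"
  proof eventually_elim
    case (elim x)
    have "?S x \<le> ereal (G x)" using elim by (intro SUP_least) (simp add: abs_le_iff)
    moreover have "ereal (Q (t1 / real (Suc 0)) x) \<le> ?S x" by (rule SUP_upper) simp
    ultimately show ?case by (cases "?S x") auto
  qed
  fix \<tau> :: "nat \<Rightarrow> real" assume "(\<forall>n. 0 < \<tau> n) \<and> \<tau> \<longlonglongrightarrow> 0"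
  then have \<tau>: "\<And>n. 0 < \<tau> n" "\<tau> \<longlonglongrightarrow> 0" by auto
  have "AE x in M. (\<lambda>n. ereal (Q (\<tau> n) x)) \<longlonglongrightarrow> ?S x"
    by (rule antitone_quotient_limit[OF t1 anti \<tau>])
  then show "AE x in M. (\<lambda>n. Q (\<tau> n) x) \<longlonglongrightarrow> real_of_ereal (?S x)"
    using fin
  proof eventually_elim
    case (elim x)
    have "ereal (real_of_ereal (?S x)) = ?S x" using elim(2) by (rule ereal_real')
    then have "(\<lambda>n. ereal (Q (\<tau> n) x)) \<longlonglongrightarrow> ereal (real_of_ereal (?S x))"
      using elim(1) by simp
    then show ?case by simp
  qed
qed

section \<open>Fixed points of a monotone and concave map\<close>

text \<open>The hypotheses on the two operators are condensed into properties of the composition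
\<open>\<Psi>(v, u) = S(\<Phi>(v), u)\<close>, in which their order-theoretic interplay through the parameter \<open>\<Phi>(v)\<close> is
already resolved. The upper bound of the range for fixed \<open>u\<close> is the trace left by the largest
parameter; it is a function in \<open>L\<^sup>2\<close> that may be essentially unbounded.\<close>

locale concave_fixed_point =
  fixes X :: "'x measure" and Y :: "'y measure" and U :: "('y \<Rightarrow> real) set"
    and S :: "'p option \<Rightarrow> ('y \<Rightarrow> real) \<Rightarrow> 'x \<Rightarrow> real" and \<Phi> :: "('x \<Rightarrow> real) \<Rightarrow> 'p"
    and \<epsilon> r :: real
  assumes r: "1 \<le> r" "r \<le> 2" and eps: "0 < \<epsilon>"
    and U_Linf: "u \<in> U \<Longrightarrow> u \<in> Linf Y"
    and U_nonneg: "u \<in> U \<Longrightarrow> AE y in Y. 0 \<le> u y"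
    and U_convex: "\<lbrakk>u1 \<in> U; u2 \<in> U; 0 \<le> l; l \<le> 1\<rbrakk> \<Longrightarrow> (\<lambda>y. l * u1 y + (1 - l) * u2 y) \<in> U"
    and U_zero: "(\<lambda>y. 0) \<in> U"
    and Psi_Lp_inf: "\<lbrakk>v \<in> Lp X 2; u \<in> U\<rbrakk> \<Longrightarrow> Psi S \<Phi> v u \<in> Lp_inf X r"
    and Psi_nonneg: "\<lbrakk>v \<in> Lp X 2; u \<in> U\<rbrakk> \<Longrightarrow> AE x in X. 0 \<le> Psi S \<Phi> v u x"
    and Psi_mono: "\<lbrakk>v1 \<in> Lp X 2; v2 \<in> Lp X 2; u1 \<in> U; u2 \<in> U; le_ae X v1 v2; le_ae Y u1 u2\<rbrakk>
      \<Longrightarrow> le_ae X (Psi S \<Phi> v1 u1) (Psi S \<Phi> v2 u2)"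
    and Psi_concave: "\<lbrakk>v1 \<in> Lp X 2; v2 \<in> Lp X 2; u1 \<in> U; u2 \<in> U; 0 \<le> l; l \<le> 1;
        AE x in X. - \<epsilon> \<le> v1 x; AE x in X. - \<epsilon> \<le> v2 x\<rbrakk> \<Longrightarrow>
      AE x in X. l * Psi S \<Phi> v1 u1 x + (1 - l) * Psi S \<Phi> v2 u2 x
        \<le> Psi S \<Phi> (\<lambda>x. l * v1 x + (1 - l) * v2 x) (\<lambda>y. l * u1 y + (1 - l) * u2 y) x"
    and Psi_le_top: "u \<in> U \<Longrightarrow> \<exists>b\<in>Lp X 2. \<forall>v\<in>Lp X 2. le_ae X (Psi S \<Phi> v u) b"
begin

abbreviation "T \<equiv> Psi S \<Phi>"

abbreviation "y \<equiv> sol X S \<Phi>"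

lemma Lp_inf_r_Lp_2: "f \<in> Lp_inf X r \<Longrightarrow> f \<in> Lp X 2"
  using Lp_inf_imp_Lp r by blast

lemma T_Lp_2: "v \<in> Lp X 2 \<Longrightarrow> u \<in> U \<Longrightarrow> T v u \<in> Lp X 2"
  using Psi_Lp_inf Lp_inf_r_Lp_2 by blast

lemma T_mono: "\<lbrakk>v1 \<in> Lp X 2; v2 \<in> Lp X 2; u \<in> U; le_ae X v1 v2\<rbrakk> \<Longrightarrow> le_ae X (T v1 u) (T v2 u)"
  by (rule Psi_mono) auto

text \<open>This is where \<open>\<epsilon>\<close> matters. For \<open>0 \<le> v \<le> M\<close> the function \<open>(1 - \<theta>) v\<close> is a convex combination of
\<open>v\<close> and of \<open>- (\<epsilon> / M) v \<ge> - \<epsilon>\<close>, where the weight of \<open>v\<close> is \<open>1 - \<theta> M / (M + \<epsilon>)\<close>. Concavity, together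
with the nonnegativity of \<open>T\<close> at the second point, transfers this larger weight to the values. So
applying \<open>T\<close> shrinks the relative deficit \<open>\<theta>\<close> by the factor \<open>M / (M + \<epsilon>) < 1\<close>: a contraction in
the order sense.\<close>

lemma T_amplifies:
  assumes v: "v \<in> Lp X 2" and u: "u \<in> U" and M: "0 < M" "AE x in X. 0 \<le> v x \<and> v x \<le> M"
    and th: "0 \<le> \<theta>" "\<theta> \<le> 1"
  shows "AE x in X. (1 - \<theta> * (M / (M + \<epsilon>))) * T v u x \<le> T (\<lambda>x. (1 - \<theta>) * v x) u x"
proof -
  let ?l = "1 - \<theta> * (M / (M + \<epsilon>))"
  \<comment> \<open>A fixed negative constant would not lie in \<open>L\<^sup>2\<close> on a space of infinite measure; a negative
    multiple of \<open>v\<close> does.\<close>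
  let ?w = "\<lambda>x. (- (\<epsilon> / M)) * v x"
  have b: "0 \<le> M / (M + \<epsilon>)" "M / (M + \<epsilon>) \<le> 1" using M eps by (auto simp: field_simps)
  have l: "0 \<le> ?l" "?l \<le> 1" using mult_nonneg_nonneg[OF th(1) b(1)] mult_le_one[OF th(2) b] by linarith+
  have w: "?w \<in> Lp X 2" by (rule Lp_scale[OF v])
  have wge: "AE x in X. - \<epsilon> \<le> ?w x"
    using M(2)
  proof eventually_elim
    case (elim x)
    have "(\<epsilon> / M) * v x \<le> (\<epsilon> / M) * M" using elim eps M by (intro mult_left_mono) auto
    then show ?case using M by simp
  qed
  have vge: "AE x in X. - \<epsilon> \<le> v x" using M(2) eps by (auto elim!: AE_mp)
  have eq: "?l * a + (1 - ?l) * ((- (\<epsilon> / M)) * a) = (1 - \<theta>) * a" for a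
  proof -
    have "M + \<epsilon> \<noteq> 0" "M \<noteq> 0" using M eps by auto
    then show ?thesis by (simp add: divide_simps) (simp add: algebra_simps)
  qed
  have "AE x in X. ?l * T v u x + (1 - ?l) * T ?w u x
      \<le> T (\<lambda>x. ?l * v x + (1 - ?l) * ?w x) (\<lambda>y. ?l * u y + (1 - ?l) * u y) x"
    by (rule Psi_concave[OF v w u u l vge wge])
  moreover have "(\<lambda>x. ?l * v x + (1 - ?l) * ?w x) = (\<lambda>x. (1 - \<theta>) * v x)"
    using eq by blast
  moreover have "(\<lambda>y. ?l * u y + (1 - ?l) * u y) = u" by (simp add: algebra_simps)
  ultimately have "AE x in X. ?l * T v u x + (1 - ?l) * T ?w u x \<le> T (\<lambda>x. (1 - \<theta>) * v x) u x"
    by simp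
  then show ?thesis using Psi_nonneg[OF w u]
  proof eventually_elim
    case (elim x)
    have "0 \<le> (1 - ?l) * T ?w u x" using elim l by (intro mult_nonneg_nonneg) auto
    then show ?case using elim by linarith
  qed
qed

text \<open>The comparison principle. Replacing the subsolution \<open>w\<close> by \<open>T w u\<close>, which is a larger
subsolution, makes it bounded and nonnegative. A supersolution \<open>v\<close> lies above \<open>0\<close> times this
function, and each application of \<open>T\<close> improves a bound of the form \<open>(1 - \<theta>) T w u \<le> v\<close> by
contracting \<open>\<theta>\<close> geometrically.\<close>

lemma subsolution_le_supersolution:
  assumes u: "u \<in> U" and v: "v \<in> Lp X 2" "le_ae X (T v u) v"
    and w: "w \<in> Lp X 2" "le_ae X w (T w u)"
  shows "le_ae X w v"
proof -
  let ?w = "T w u"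
  have w': "?w \<in> Lp X 2" "?w \<in> Lp_inf X r" using T_Lp_2 Psi_Lp_inf w u by auto
  have sub: "le_ae X ?w (T ?w u)" by (rule T_mono[OF w(1) w'(1) u w(2)])
  obtain M where M: "0 < M" "AE x in X. \<bar>?w x\<bar> \<le> M" using Lp_inf_bounded[OF w'(2)] .
  have M': "AE x in X. 0 \<le> ?w x \<and> ?w x \<le> M"
    using M(2) Psi_nonneg[OF w(1) u] by eventually_elim auto
  let ?b = "M / (M + \<epsilon>)"
  have b: "0 \<le> ?b" "?b < 1" using M eps by (auto simp: field_simps)
  have "AE x in X. (1 - ?b ^ n) * ?w x \<le> v x" for n
  proof (induction n)
    case 0
    show ?case using v(2) Psi_nonneg[OF v(1) u] by eventually_elim auto
  next
    case (Suc n)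
    have pw: "0 \<le> ?b ^ n" "?b ^ n \<le> 1" using b by (auto intro: power_le_one)
    have scaled: "(\<lambda>x. (1 - ?b ^ n) * ?w x) \<in> Lp X 2" by (rule Lp_scale[OF w'(1)])
    from T_amplifies[OF w'(1) u M(1) M' pw] T_mono[OF scaled v(1) u Suc.IH] sub v(2)
    show ?case
    proof eventually_elim
      case (elim x)
      have "?b ^ n * ?b \<le> 1" by (rule mult_le_one[OF pw(2) b(1) less_imp_le[OF b(2)]])
      then have "(1 - ?b ^ n * ?b) * ?w x \<le> (1 - ?b ^ n * ?b) * T ?w u x"
        using elim by (intro mult_left_mono) auto
      then show ?case using elim by (simp add: mult.commute)
    qed
  qed
  then have "le_ae X ?w v" by (rule AE_le_of_geometric[OF b])
  then show ?thesis using w(2) by eventually_elim auto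
qed

text \<open>Iterating \<open>T\<close> from \<open>T top\<close> gives a decreasing sequence of bounded nonnegative functions \<open>z n\<close>. Monotonicity
alone shows only that the limit \<open>v\<close> is a supersolution, since \<open>T\<close> is not assumed to be continuous.
The contraction of relative deficits gives \<open>(1 - b\<^sup>n) z n \<le> z (n + k)\<close> for all \<open>k\<close>, hence
\<open>(1 - b\<^sup>n) z n \<le> v\<close>; applying \<open>T\<close> once more to this bound shows that \<open>v\<close> is also a subsolution.\<close>

lemma solution_exists:
  assumes u: "u \<in> U"
  shows "\<exists>v. is_solution X S \<Phi> u v"
proof -
  obtain top where top: "top \<in> Lp X 2" "\<And>v. v \<in> Lp X 2 \<Longrightarrow> le_ae X (T v u) top"
    using Psi_le_top[OF u] by blast
  define z where "z n = ((\<lambda>v. T v u) ^^ n) (T top u)" for n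
  have z_Suc: "z (Suc n) = T (z n) u" for n by (simp add: z_def)
  have z_Lp: "z n \<in> Lp X 2" "AE x in X. 0 \<le> z n x" for n
  proof (induction n)
    case 0
    { case 1 show ?case using T_Lp_2 top u by (simp add: z_def) }
    { case 2 show ?case using Psi_nonneg top u by (simp add: z_def) }
  next
    case (Suc n)
    { case 1 show ?case using T_Lp_2 Suc u by (simp add: z_Suc) }
    { case 2 show ?case using Psi_nonneg Suc u by (simp add: z_Suc) }
  qed
  have dec: "le_ae X (z (Suc n)) (z n)" for n
  proof (induction n)
    case 0
    have "le_ae X (T (T top u) u) (T top u)"
      by (rule T_mono) (use T_Lp_2 top u in auto)
    then show ?case by (simp add: z_def)
  next
    case (Suc n)
    show ?case using T_mono[OF z_Lp(1) z_Lp(1) u Suc] by (simp only: z_Suc)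
  qed
  have "z 0 \<in> Lp_inf X r" using Psi_Lp_inf top u by (simp add: z_def)
  then obtain M where M: "0 < M" "AE x in X. \<bar>z 0 x\<bar> \<le> M" using Lp_inf_bounded by blast
  have zM: "AE x in X. 0 \<le> z n x \<and> z n x \<le> M" for n
  proof (induction n)
    case 0
    show ?case using M(2) z_Lp(2)[of 0] by eventually_elim auto
  next
    case (Suc n)
    then show ?case using dec[of n] z_Lp(2)[of "Suc n"] by eventually_elim auto
  qed
  let ?b = "M / (M + \<epsilon>)"
  have b: "0 \<le> ?b" "?b < 1" using M eps by (auto simp: field_simps)
  have pw: "0 \<le> ?b ^ n" "?b ^ n \<le> 1" for n using b by (auto intro: power_le_one)
  have step: "AE x in X. (1 - ?b ^ Suc n) * z (Suc n) x \<le> T (\<lambda>x. (1 - ?b ^ n) * z n x) u x" for n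
    using T_amplifies[OF z_Lp(1) u M(1) zM pw] by (simp add: z_Suc mult.commute)
  have tail: "AE x in X. (1 - ?b ^ n) * z n x \<le> z (n + k) x" for n k
  proof (induction n)
    case 0
    show ?case using z_Lp(2)[of k] by simp
  next
    case (Suc n)
    have "le_ae X (T (\<lambda>x. (1 - ?b ^ n) * z n x) u) (T (z (n + k)) u)"
      by (rule T_mono[OF Lp_scale[OF z_Lp(1)] z_Lp(1) u Suc.IH])
    then show ?case using step[of n] by eventually_elim (simp add: z_Suc)
  qed
  define v where "v x = lim (\<lambda>n. z n x)" for x
  have zmeas[measurable]: "z n \<in> borel_measurable X" for n
    using z_Lp(1) by (rule Lp_measurable)
  have vmeas: "v \<in> borel_measurable X"
    unfolding v_def by measurable
  have "AE x in X. \<forall>n. z (Suc n) x \<le> z n x \<and> 0 \<le> z n x"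
    unfolding AE_all_countable using dec z_Lp(2) by (auto intro: AE_conjI)
  then have v_lim: "AE x in X. decseq (\<lambda>n. z n x) \<and> (\<lambda>n. z n x) \<longlonglongrightarrow> v x"
  proof eventually_elim
    case (elim x)
    then have d: "decseq (\<lambda>n. z n x)" by (simp add: decseq_SucI)
    have "convergent (\<lambda>n. z n x)"
      using decseq_convergent[OF d, of 0] elim unfolding convergent_def by blast
    then show ?case using d by (simp add: v_def convergent_LIMSEQ_iff)
  qed
  have v_le: "le_ae X v (z n)" for n
    using v_lim by eventually_elim (auto intro: decseq_ge)
  have v_ge: "AE x in X. (1 - ?b ^ n) * z n x \<le> v x" for n
  proof -
    have "AE x in X. \<forall>k. (1 - ?b ^ n) * z n x \<le> z (n + k) x"
      using tail by (simp add: AE_all_countable)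
    then show ?thesis using v_lim
    proof eventually_elim
      case (elim x)
      have "(\<lambda>k. z (n + k) x) \<longlonglongrightarrow> v x"
        using LIMSEQ_ignore_initial_segment[of "\<lambda>n. z n x" "v x" n] elim
        by (simp add: add.commute)
      then show ?case using elim by (intro LIMSEQ_le_const) auto
    qed
  qed
  have v_nonneg: "AE x in X. 0 \<le> v x" using v_ge[of 0] by simp
  have v_Lp: "v \<in> Lp X 2"
    by (rule Lp_dominated[OF z_Lp(1)[of 0] vmeas])
       (use v_nonneg v_le[of 0] in \<open>auto elim!: AE_mp\<close>)
  have "le_ae X (T v u) v"
  proof -
    have "le_ae X (T v u) (z (Suc n))" for n
      unfolding z_Suc by (rule T_mono[OF v_Lp z_Lp(1) u v_le])
    then have "AE x in X. \<forall>n. T v u x \<le> z (Suc n) x" by (simp add: AE_all_countable)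
    then show ?thesis using v_lim
      by eventually_elim (auto intro!: LIMSEQ_le_const[OF LIMSEQ_Suc])
  qed
  moreover have "le_ae X v (T v u)"
  proof (rule AE_le_of_geometric[OF b])
    fix n
    have "le_ae X (T (\<lambda>x. (1 - ?b ^ n) * z n x) u) (T v u)"
      by (rule T_mono[OF Lp_scale[OF z_Lp(1)] v_Lp u v_ge])
    then show "AE x in X. (1 - ?b ^ n) * v x \<le> T v u x"
      using step[of n] v_le[of "Suc n"] v_nonneg
    proof eventually_elim
      case (elim x)
      have "(1 - ?b ^ n) * v x \<le> (1 - ?b ^ Suc n) * v x"
        using elim(4) b pw[of n] mult_right_mono[of ?b 1 "?b ^ n"]
        by (intro mult_right_mono) (auto)
      also have "\<dots> \<le> (1 - ?b ^ Suc n) * z (Suc n) x"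
        using elim pw[of "Suc n"] by (intro mult_left_mono) auto
      finally show ?case using elim by linarith
    qed
  qed
  ultimately have "eq_ae X v (T v u)" by eventually_elim auto
  then show ?thesis using v_Lp by (auto simp: is_solution_def Psi_def)
qed

lemma sol_is_solution: "u \<in> U \<Longrightarrow> is_solution X S \<Phi> u (y u)"
  unfolding sol_def using solution_exists by (rule someI_ex)

lemma sol_Lp_2: "u \<in> U \<Longrightarrow> y u \<in> Lp X 2"
  using sol_is_solution by (simp add: is_solution_def)

lemma sol_fixed: "u \<in> U \<Longrightarrow> eq_ae X (y u) (T (y u) u)"
  using sol_is_solution by (simp add: is_solution_def Psi_def)

lemma sol_nonneg: "u \<in> U \<Longrightarrow> AE x in X. 0 \<le> y u x"
  using sol_fixed[of u] Psi_nonneg[OF sol_Lp_2, of u u] by (auto elim!: AE_mp)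

lemma sol_Lp_inf:
  assumes u: "u \<in> U"
  shows "y u \<in> Lp_inf X r"
  by (rule Lp_inf_dominated[OF Psi_Lp_inf[OF sol_Lp_2[OF u] u] Lp_measurable[OF sol_Lp_2[OF u]]])
     (use r sol_fixed[OF u] in \<open>auto elim!: AE_mp\<close>)

lemma subsolution_le_sol:
  assumes "u \<in> U" "w \<in> Lp X 2" "le_ae X w (T w u)"
  shows "le_ae X w (y u)"
  by (rule subsolution_le_supersolution[OF assms(1) sol_Lp_2[OF assms(1)] _ assms(2,3)])
     (use sol_fixed[OF assms(1)] in \<open>auto elim!: AE_mp\<close>)

lemma sol_le_supersolution:
  assumes "u \<in> U" "v \<in> Lp X 2" "le_ae X (T v u) v"
  shows "le_ae X (y u) v"
  by (rule subsolution_le_supersolution[OF assms sol_Lp_2[OF assms(1)]])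
     (use sol_fixed[OF assms(1)] in \<open>auto elim!: AE_mp\<close>)

lemma solution_unique:
  assumes u: "u \<in> U" and z: "is_solution X S \<Phi> u z"
  shows "eq_ae X z (y u)"
proof -
  have z': "z \<in> Lp X 2" "eq_ae X z (T z u)" using z by (auto simp: is_solution_def Psi_def)
  have "le_ae X z (y u)" by (rule subsolution_le_sol[OF u z'(1)]) (use z'(2) in \<open>auto elim!: AE_mp\<close>)
  moreover have "le_ae X (y u) z"
    by (rule sol_le_supersolution[OF u z'(1)]) (use z'(2) in \<open>auto elim!: AE_mp\<close>)
  ultimately show ?thesis by eventually_elim auto
qed

section \<open>The solution map\<close>

text \<open>The solution map inherits monotonicity and concavity from \<open>\<Psi>\<close>, because solutions, and convex combinations of
solutions, are subsolutions of the problem they are compared with.\<close>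

lemma sol_mono:
  assumes "u1 \<in> U" "u2 \<in> U" "le_ae Y u1 u2"
  shows "le_ae X (y u1) (y u2)"
proof (rule subsolution_le_sol[OF assms(2) sol_Lp_2[OF assms(1)]])
  have "le_ae X (T (y u1) u1) (T (y u1) u2)"
    by (rule Psi_mono) (use assms sol_Lp_2 in auto)
  then show "le_ae X (y u1) (T (y u1) u2)"
    using sol_fixed[OF assms(1)] by eventually_elim auto
qed

lemma sol_concave:
  assumes u: "u1 \<in> U" "u2 \<in> U" and l: "0 \<le> l" "l \<le> 1"
  shows "AE x in X. l * y u1 x + (1 - l) * y u2 x \<le> y (\<lambda>y. l * u1 y + (1 - l) * u2 y) x"
proof (rule subsolution_le_sol[OF U_convex[OF u l]])
  show "(\<lambda>x. l * y u1 x + (1 - l) * y u2 x) \<in> Lp X 2"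
    by (rule Lp_lincomb) (use sol_Lp_2 u in auto)
  have ge: "AE x in X. - \<epsilon> \<le> y u x" if "u \<in> U" for u
    using sol_nonneg[OF that] eps by (auto elim!: AE_mp)
  show "le_ae X (\<lambda>x. l * y u1 x + (1 - l) * y u2 x)
      (T (\<lambda>x. l * y u1 x + (1 - l) * y u2 x) (\<lambda>y. l * u1 y + (1 - l) * u2 y))"
    using Psi_concave[OF sol_Lp_2[OF u(1)] sol_Lp_2[OF u(2)] u l ge[OF u(1)] ge[OF u(2)]]
      sol_fixed[OF u(1)] sol_fixed[OF u(2)]
    by eventually_elim auto
qed

text \<open>Concavity between \<open>u\<close> and the admissible parameter \<open>0\<close>, where the solution is nonnegative.\<close>

lemma sol_scaled:
  assumes u: "u \<in> U" and w: "w \<in> U" and l: "0 \<le> l" "l \<le> 1" and le: "AE t in Y. l * u t \<le> w t"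
  shows "AE x in X. l * y u x \<le> y w x"
proof -
  let ?lu = "\<lambda>y. l * u y + (1 - l) * 0"
  have "?lu \<in> U" using U_convex[OF u U_zero l] by simp
  then have "le_ae X (y ?lu) (y w)" by (rule sol_mono) (use w le in auto)
  then show ?thesis using sol_concave[OF u U_zero l] sol_nonneg[OF U_zero]
  proof eventually_elim
    case (elim x)
    have "0 \<le> (1 - l) * y (\<lambda>y. 0) x" using elim l by simp
    then show ?case using elim by linarith
  qed
qed

text \<open>If \<open>u \<ge> c > 0\<close>, then a perturbation of size \<open>d\<close> is at most \<open>(d / c) u\<close>, so \<open>w\<close> lies between
\<open>(1 - d / c) u\<close> and \<open>(1 + d / c) u\<close>, and the scaling property turns this into a two-sided bound on
the solutions. For \<open>d > c\<close> the lower factor is negative, and nonnegativity of solutions gives that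
bound instead. The result is pointwise, with the fixed function \<open>y u\<close> as a
weight; this is what later dominates all difference quotients.\<close>

lemma sol_lipschitz:
  assumes u: "u \<in> U" "0 < c" "AE t in Y. c \<le> u t" and w: "w \<in> U"
    and d: "0 \<le> d" "AE t in Y. \<bar>w t - u t\<bar> \<le> d"
  shows "AE x in X. \<bar>y w x - y u x\<bar> \<le> d / c * y u x"
proof -
  have dc: "0 \<le> d / c" using d u by simp
  have du: "AE t in Y. d \<le> d / c * u t"
    using u(3)
  proof eventually_elim
    case (elim t)
    have "d / c * c \<le> d / c * u t" by (rule mult_left_mono[OF elim dc])
    then show ?case using u(2) by simp
  qed
  have lower: "AE x in X. (1 - d / c) * y u x \<le> y w x"
  proof (cases "d / c \<le> 1")
    case True
    show ?thesis
    proof (rule sol_scaled[OF u(1) w])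
      show "AE t in Y. (1 - d / c) * u t \<le> w t"
        using du d(2) by eventually_elim (simp add: algebra_simps abs_le_iff)
    qed (use True dc in auto)
  next
    case False
    show ?thesis using sol_nonneg[OF u(1)] sol_nonneg[OF w]
    proof eventually_elim
      case (elim x)
      have "(1 - d / c) * y u x \<le> 0" using False elim by (intro mult_nonpos_nonneg) auto
      then show ?case using elim by linarith
    qed
  qed
  have upper: "AE x in X. 1 / (1 + d / c) * y w x \<le> y u x"
  proof (rule sol_scaled[OF w u(1)])
    show "AE t in Y. 1 / (1 + d / c) * w t \<le> u t"
      using du d(2)
    proof eventually_elim
      case (elim t)
      then have "w t \<le> (1 + d / c) * u t" by (simp add: algebra_simps abs_le_iff)
      then show ?case using dc by (simp add: pos_divide_le_eq mult.commute)
    qed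
  qed (use dc in auto)
  from lower upper show ?thesis
  proof eventually_elim
    case (elim x)
    have "y w x \<le> (1 + d / c) * y u x"
      using elim(2) dc by (simp add: pos_divide_le_eq mult.commute)
    then show ?case using elim(1) by (simp add: algebra_simps abs_le_iff)
  qed
qed

end

context concave_fixed_point
begin

section \<open>Directional derivatives of the concave map\<close>

lemma U_segment:
  assumes u: "u \<in> U" "(\<lambda>y. u y + t0 * h y) \<in> U" and t: "0 \<le> t" "t \<le> t0" "0 < t0"
  shows "(\<lambda>y. u y + t * h y) \<in> U"
proof -
  have "(\<lambda>y. (t / t0) * (u y + t0 * h y) + (1 - t / t0) * u y) \<in> U"
    by (rule U_convex[OF u(2,1)]) (use t in auto)
  moreover have "(t / t0) * (u y + t0 * h y) + (1 - t / t0) * u y = u y + t * h y" for y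
    using t by (simp add: field_simps)
  ultimately show ?thesis by simp
qed

lemma cone_segment:
  assumes "h \<in> cone_at U u"
  obtains t0 where "0 < t0" "(\<lambda>y. u y + t0 * h y) \<in> U"
proof -
  obtain l w where lw: "0 < l" "w \<in> U" "h = (\<lambda>y. l * (w y - u y))"
    using assms by (auto simp: cone_at_def)
  show thesis
  proof
    show "0 < 1 / l" using lw by simp
    have "(\<lambda>y. u y + 1 / l * h y) = w" using lw by auto
    then show "(\<lambda>y. u y + 1 / l * h y) \<in> U" using lw by simp
  qed
qed

lemma cone_Linf:
  assumes "u \<in> U" "h \<in> cone_at U u"
  shows "h \<in> Linf Y"
proof -
  obtain l w where lw: "0 < l" "w \<in> U" "h = (\<lambda>y. l * (w y - u y))"
    using assms by (auto simp: cone_at_def)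
  have eq: "h = (\<lambda>y. l * w y + (- l) * u y)" using lw by (simp add: algebra_simps)
  show ?thesis unfolding eq by (rule Linf_lincomb[OF U_Linf[OF lw(2)] U_Linf[OF assms(1)]])
qed

definition sol_quotient where
  "sol_quotient u h t x = (y (\<lambda>s. u s + t * h s) x - y u x) / t"

definition T_quotient where
  "T_quotient v u h1 h2 t x = (T (\<lambda>x. v x + t * h1 x) (\<lambda>y. u y + t * h2 y) x - T v u x) / t"

lemma sol_quotient_antitone:
  assumes u: "u \<in> U" "(\<lambda>y. u y + t * h y) \<in> U" and st: "0 < s" "s \<le> t"
  shows "AE x in X. sol_quotient u h t x \<le> sol_quotient u h s x"
proof -
  have "AE x in X. (s / t) * y (\<lambda>y. u y + t * h y) x + (1 - s / t) * y u x
      \<le> y (\<lambda>a. (s / t) * (u a + t * h a) + (1 - s / t) * u a) x"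
    by (rule sol_concave[OF u(2,1)]) (use st in auto)
  moreover have "(s / t) * (u a + t * h a) + (1 - s / t) * u a = u a + s * h a" for a
    using st by (simp add: field_simps)
  ultimately have "AE x in X. (s / t) * y (\<lambda>y. u y + t * h y) x + (1 - s / t) * y u x
      \<le> y (\<lambda>y. u y + s * h y) x" by simp
  then show ?thesis unfolding sol_quotient_def
    by eventually_elim (rule concave_quotient_antitone[OF st])
qed

lemma T_quotient_antitone:
  assumes v: "v \<in> Lp X 2" "AE x in X. 0 \<le> v x" and u: "u \<in> U" "(\<lambda>y. u y + t * h2 y) \<in> U"
    and h1: "h1 \<in> Lp X 2" "AE x in X. - \<epsilon> \<le> v x + t * h1 x" and st: "0 < s" "s \<le> t"
  shows "AE x in X. T_quotient v u h1 h2 t x \<le> T_quotient v u h1 h2 s x"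
proof -
  have v1: "(\<lambda>x. v x + t * h1 x) \<in> Lp X 2" using Lp_lincomb[OF v(1) h1(1), of 1 t] by simp
  have ge: "AE x in X. - \<epsilon> \<le> v x" using v(2) eps by (auto elim!: AE_mp)
  have "AE x in X. (s / t) * T (\<lambda>x. v x + t * h1 x) (\<lambda>y. u y + t * h2 y) x + (1 - s / t) * T v u x
      \<le> T (\<lambda>x. (s / t) * (v x + t * h1 x) + (1 - s / t) * v x)
          (\<lambda>a. (s / t) * (u a + t * h2 a) + (1 - s / t) * u a) x"
    by (rule Psi_concave[OF v1 v(1) u(2,1) _ _ h1(2) ge]) (use st in auto)
  moreover have "(s / t) * (f + t * g) + (1 - s / t) * f = f + s * g" for f g
    using st by (simp add: field_simps)
  ultimately have "AE x in X. (s / t) * T (\<lambda>x. v x + t * h1 x) (\<lambda>y. u y + t * h2 y) x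
      + (1 - s / t) * T v u x \<le> T (\<lambda>x. v x + s * h1 x) (\<lambda>y. u y + s * h2 y) x" by simp
  then show ?thesis unfolding T_quotient_def
    by eventually_elim (rule concave_quotient_antitone[OF st])
qed

lemma is_Psi_derivD:
  assumes "is_Psi_deriv X U S \<Phi> v u h1 h2 D" "0 < t0" "(\<lambda>s. u s + t0 * h2 s) \<in> U"
    "\<And>n. 0 < \<tau> n" "\<And>n. \<tau> n < t0" "\<tau> \<longlonglongrightarrow> 0"
  shows "AE x in X. (\<lambda>n. ereal (T_quotient v u h1 h2 (\<tau> n) x)) \<longlonglongrightarrow> D x"
  using assms unfolding is_Psi_deriv_def T_quotient_def by blast

text \<open>Concavity of \<open>\<Psi>\<close> is at hand only above \<open>- \<epsilon>\<close>. A step size that keeps \<open>v + t h\<close> there works for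
every \<open>g \<ge> h\<close> as well, which is needed for increasing sequences of directions.\<close>

lemma small_step:
  assumes h1: "h1 \<in> Lp_inf X q" and t0: "0 < t0" and v: "AE x in X. 0 \<le> v x"
  shows "\<exists>t1>0. t1 \<le> t0 \<and>
    (\<forall>t g. 0 \<le> t \<longrightarrow> t \<le> t1 \<longrightarrow> le_ae X h1 g \<longrightarrow> (AE x in X. - \<epsilon> \<le> v x + t * g x))"
proof -
  obtain C where C: "0 < C" "AE x in X. \<bar>h1 x\<bar> \<le> C" using Lp_inf_bounded[OF h1] .
  show ?thesis
  proof (intro exI conjI allI impI)
    show "0 < min t0 (\<epsilon> / C)" using t0 eps C by simp
    show "min t0 (\<epsilon> / C) \<le> t0" by simp
    fix t g assume t: "0 \<le> t" "t \<le> min t0 (\<epsilon> / C)" and g: "le_ae X h1 g"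
    show "AE x in X. - \<epsilon> \<le> v x + t * g x"
      using C(2) v g
    proof eventually_elim
      case (elim x)
      have "t * C \<le> \<epsilon>" using t C by (simp add: pos_le_divide_eq)
      moreover have "t * (- C) \<le> t * g x" using elim t by (intro mult_left_mono) auto
      ultimately show ?case using elim by simp
    qed
  qed
qed

text \<open>Difference quotients of \<open>\<Psi>\<close> increase as the step decreases, and so converge to a limit that may
be \<open>\<infinity>\<close> but not \<open>- \<infinity>\<close>, as it lies above a real-valued quotient.\<close>

lemma Psi_deriv_exists:
  assumes v: "v \<in> Lp X 2" "AE x in X. 0 \<le> v x" and u: "u \<in> U"
    and h1: "h1 \<in> Lp_inf X 2" and h2: "h2 \<in> cone_at U u"
  shows "\<exists>D. is_Psi_deriv X U S \<Phi> v u h1 h2 D \<and>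
    (\<forall>\<tau>. (\<forall>n::nat. 0 < \<tau> n) \<longrightarrow> \<tau> \<longlonglongrightarrow> 0 \<longrightarrow>
      (AE x in X. (\<lambda>n. ereal (T_quotient v u h1 h2 (\<tau> n) x)) \<longlonglongrightarrow> D x)) \<and>
    (\<forall>D'. is_Psi_deriv X U S \<Phi> v u h1 h2 D' \<longrightarrow> eq_ae X D' D)"
proof -
  obtain t0 where t0: "0 < t0" "(\<lambda>y. u y + t0 * h2 y) \<in> U" using cone_segment[OF h2] .
  obtain t1 where t1: "0 < t1" "t1 \<le> t0"
    and ge: "\<And>t g. 0 \<le> t \<Longrightarrow> t \<le> t1 \<Longrightarrow> le_ae X h1 g \<Longrightarrow> AE x in X. - \<epsilon> \<le> v x + t * g x"
    using small_step[OF h1 t0(1) v(2)] by blast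
  have h1': "h1 \<in> Lp X 2" using h1 by (simp add: Lp_inf_def)
  have inU: "(\<lambda>y. u y + t * h2 y) \<in> U" if "0 \<le> t" "t \<le> t1" for t
    by (rule U_segment[OF u t0(2)]) (use that t0 t1 in auto)
  have inLp: "(\<lambda>x. v x + t * h1 x) \<in> Lp X 2" for t
    using Lp_lincomb[OF v(1) h1', of 1 t] by simp
  define D where "D x = (SUP k. ereal (T_quotient v u h1 h2 (t1 / real (Suc k)) x))" for x
  have lim: "AE x in X. (\<lambda>n. ereal (T_quotient v u h1 h2 (\<tau> n) x)) \<longlonglongrightarrow> D x"
    if "\<And>n::nat. 0 < \<tau> n" "\<tau> \<longlonglongrightarrow> 0" for \<tau>
    unfolding D_def
  proof (rule antitone_quotient_limit[OF t1(1) _ that])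
    fix s t :: real assume st: "0 < s" "s \<le> t" "t \<le> t1"
    show "AE x in X. T_quotient v u h1 h2 t x \<le> T_quotient v u h1 h2 s x"
      by (rule T_quotient_antitone[OF v u inU h1' ge]) (use st in auto)
  qed
  have D: "is_Psi_deriv X U S \<Phi> v u h1 h2 D"
    unfolding is_Psi_deriv_def
  proof (intro conjI ballI allI impI)
    have [measurable]: "T_quotient v u h1 h2 (t1 / real (Suc k)) \<in> borel_measurable X" for k
    proof -
      have k: "0 \<le> t1 / real (Suc k)" "t1 / real (Suc k) \<le> t1"
        using t1 by (auto simp: field_simps)
      have [measurable]: "T (\<lambda>x. v x + t1 / real (Suc k) * h1 x) (\<lambda>y. u y + t1 / real (Suc k) * h2 y)
          \<in> borel_measurable X"
        by (rule Lp_measurable[OF T_Lp_2[OF inLp inU[OF k]]])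
      have [measurable]: "T v u \<in> borel_measurable X"
        by (rule Lp_measurable[OF T_Lp_2[OF v(1) u]])
      show ?thesis unfolding T_quotient_def by measurable
    qed
    show "D \<in> borel_measurable X" unfolding D_def by measurable
    fix x
    have "ereal (T_quotient v u h1 h2 (t1 / real (Suc 0)) x) \<le> D x"
      unfolding D_def by (rule SUP_upper) simp
    then show "D x \<noteq> - \<infinity>" by auto
  next
    fix t and \<tau> :: "nat \<Rightarrow> real" assume "(\<forall>n. 0 < \<tau> n \<and> \<tau> n < t) \<and> \<tau> \<longlonglongrightarrow> 0"
    then show "AE x in X. (\<lambda>n. ereal ((T (\<lambda>x. v x + \<tau> n * h1 x) (\<lambda>y. u y + \<tau> n * h2 y) x
        - T v u x) / \<tau> n)) \<longlonglongrightarrow> D x"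
      using lim[of \<tau>] by (simp add: T_quotient_def)
  qed
  have uniq: "eq_ae X D' D" if D': "is_Psi_deriv X U S \<Phi> v u h1 h2 D'" for D'
  proof -
    let ?\<tau> = "\<lambda>n. t0 / real (Suc (Suc n))"
    note \<tau> = null_steps[OF t0(1)]
    have "AE x in X. (\<lambda>n. ereal (T_quotient v u h1 h2 (?\<tau> n) x)) \<longlonglongrightarrow> D' x"
      by (rule is_Psi_derivD[OF D' t0 \<tau>(1-3)])
    then show ?thesis using lim[OF \<tau>(1,3)]
      by eventually_elim (rule LIMSEQ_unique)
  qed
  show ?thesis using D lim uniq by blast
qed

lemma Psi_deriv_limit:
  assumes v: "v \<in> Lp X 2" "AE x in X. 0 \<le> v x" and u: "u \<in> U"
    and h1: "h1 \<in> Lp_inf X 2" and h2: "h2 \<in> cone_at U u"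
    and \<tau>: "\<And>n::nat. 0 < \<tau> n" "\<tau> \<longlonglongrightarrow> 0"
  shows "AE x in X. (\<lambda>n. ereal (T_quotient v u h1 h2 (\<tau> n) x))
    \<longlonglongrightarrow> Psi_deriv X U S \<Phi> v u h1 h2 x"
proof -
  obtain D where D: "is_Psi_deriv X U S \<Phi> v u h1 h2 D"
    "AE x in X. (\<lambda>n. ereal (T_quotient v u h1 h2 (\<tau> n) x)) \<longlonglongrightarrow> D x"
    "\<And>D'. is_Psi_deriv X U S \<Phi> v u h1 h2 D' \<Longrightarrow> eq_ae X D' D"
    using Psi_deriv_exists[OF v u h1 h2] \<tau> by blast
  have "is_Psi_deriv X U S \<Phi> v u h1 h2 (Psi_deriv X U S \<Phi> v u h1 h2)"
    unfolding Psi_deriv_def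
    using someI[of "is_Psi_deriv X U S \<Phi> v u h1 h2", OF D(1)] .
  from D(3)[OF this] D(2) show ?thesis by eventually_elim simp
qed

text \<open>The derivative is the supremum of the quotients whose step stays in the region of concavity.\<close>

lemma T_quotient_le_Psi_deriv:
  assumes v: "v \<in> Lp X 2" "AE x in X. 0 \<le> v x" and u: "u \<in> U"
    and h1: "h1 \<in> Lp_inf X 2" "AE x in X. - \<epsilon> \<le> v x + t * h1 x"
    and t: "0 < t" "(\<lambda>y. u y + t * h2 y) \<in> U" and h2: "h2 \<in> cone_at U u"
  shows "AE x in X. ereal (T_quotient v u h1 h2 t x) \<le> Psi_deriv X U S \<Phi> v u h1 h2 x"
proof -
  have h1': "h1 \<in> Lp X 2" using h1 by (simp add: Lp_inf_def)
  let ?\<tau> = "\<lambda>n. t / real (Suc n)"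
  have \<tau>: "\<And>n. 0 < ?\<tau> n" "\<And>n. ?\<tau> n \<le> t" "?\<tau> \<longlonglongrightarrow> 0"
    using t LIMSEQ_Suc[OF lim_const_over_n[of t]] by (auto simp: field_simps)
  have "AE x in X. \<forall>n. T_quotient v u h1 h2 t x \<le> T_quotient v u h1 h2 (?\<tau> n) x"
    unfolding AE_all_countable using T_quotient_antitone[OF v u t(2) h1' h1(2) \<tau>(1,2)] by blast
  then show ?thesis using Psi_deriv_limit[OF v u h1(1) h2 \<tau>(1,3)]
  proof eventually_elim
    case (elim x)
    show ?case by (rule LIMSEQ_le_const[OF elim(2)]) (use elim(1) in auto)
  qed
qed

lemma Psi_deriv_mono:
  assumes v: "v \<in> Lp X 2" "AE x in X. 0 \<le> v x" and u: "u \<in> U"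
    and g: "g1 \<in> Lp_inf X 2" "g2 \<in> Lp_inf X 2" "le_ae X g1 g2" and h: "h \<in> cone_at U u"
  shows "le_ae X (Psi_deriv X U S \<Phi> v u g1 h) (Psi_deriv X U S \<Phi> v u g2 h)"
proof -
  obtain t0 where t0: "0 < t0" "(\<lambda>y. u y + t0 * h y) \<in> U" using cone_segment[OF h] .
  let ?\<tau> = "\<lambda>n. t0 / real (Suc n)"
  have \<tau>: "\<And>n. 0 < ?\<tau> n" "\<And>n. ?\<tau> n \<le> t0" "?\<tau> \<longlonglongrightarrow> 0"
    using t0 LIMSEQ_Suc[OF lim_const_over_n[of t0]] by (auto simp: field_simps)
  have Lp: "(\<lambda>x. v x + t * g x) \<in> Lp X 2" if "g \<in> Lp_inf X 2" for g t
    using Lp_lincomb[OF v(1), of g 1 t] that by (simp add: Lp_inf_def)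
  have "AE x in X. T_quotient v u g1 h (?\<tau> n) x \<le> T_quotient v u g2 h (?\<tau> n) x" for n
  proof -
    have inU: "(\<lambda>y. u y + ?\<tau> n * h y) \<in> U"
      by (rule U_segment[OF u t0(2) _ \<tau>(2) t0(1)]) (use \<tau>(1)[of n] in auto)
    have "le_ae X (\<lambda>x. v x + ?\<tau> n * g1 x) (\<lambda>x. v x + ?\<tau> n * g2 x)"
      using g(3) by eventually_elim (intro add_left_mono mult_left_mono less_imp_le[OF \<tau>(1)])
    from T_mono[OF Lp[OF g(1)] Lp[OF g(2)] inU this]
    show ?thesis unfolding T_quotient_def
      by eventually_elim (intro divide_right_mono diff_right_mono less_imp_le[OF \<tau>(1)])
  qed
  then have "AE x in X. \<forall>n. T_quotient v u g1 h (?\<tau> n) x \<le> T_quotient v u g2 h (?\<tau> n) x"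
    unfolding AE_all_countable by blast
  then show ?thesis
    using Psi_deriv_limit[OF v u g(1) h \<tau>(1,3)] Psi_deriv_limit[OF v u g(2) h \<tau>(1,3)]
  proof eventually_elim
    case (elim x)
    show ?case by (rule LIMSEQ_le[OF elim(2,3)]) (use elim(1) in auto)
  qed
qed

section \<open>The directional derivative of the solution map\<close>

text \<open>Directional differentiability along a fixed direction, in the sense of a.e. convergence. The
Hadamard derivative will turn out to be the same function.\<close>

definition is_quotient_limit where
  "is_quotient_limit u h d \<longleftrightarrow> d \<in> borel_measurable X \<and>
     (\<forall>\<tau>::nat \<Rightarrow> real. (\<forall>n. 0 < \<tau> n) \<and> \<tau> \<longlonglongrightarrow> 0 \<longrightarrow>
       (AE x in X. (\<lambda>n. sol_quotient u h (\<tau> n) x) \<longlonglongrightarrow> d x))"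

lemma quotient_limitD:
  assumes "is_quotient_limit u h d" "\<And>n. 0 < \<tau> n" "\<tau> \<longlonglongrightarrow> 0"
  shows "AE x in X. (\<lambda>n. sol_quotient u h (\<tau> n) x) \<longlonglongrightarrow> d x"
  using assms unfolding is_quotient_limit_def by blast

lemma sol_quotient_bound:
  assumes u: "u \<in> U" "0 < c" "AE s in Y. c \<le> u s" and t: "0 < t" "(\<lambda>s. u s + t * h s) \<in> U"
    and K: "0 \<le> K" "AE s in Y. \<bar>h s\<bar> \<le> K"
  shows "AE x in X. \<bar>sol_quotient u h t x\<bar> \<le> K / c * y u x"
proof -
  have "AE s in Y. \<bar>(u s + t * h s) - u s\<bar> \<le> t * K"
    using K(2) by eventually_elim (use t in \<open>auto simp: abs_mult\<close>)
  from sol_lipschitz[OF u t(2) _ this] have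
    "AE x in X. \<bar>y (\<lambda>s. u s + t * h s) x - y u x\<bar> \<le> t * K / c * y u x" using t K by simp
  then show ?thesis unfolding sol_quotient_def
    by eventually_elim (use t in \<open>auto simp: field_simps abs_mult\<close>)
qed

lemma sol_quotient_Lp_inf:
  assumes u: "u \<in> U" "(\<lambda>s. u s + t * h s) \<in> U"
  shows "sol_quotient u h t \<in> Lp_inf X r"
proof -
  have eq: "sol_quotient u h t = (\<lambda>x. (1 / t) * y (\<lambda>s. u s + t * h s) x + (- 1 / t) * y u x)"
    by (auto simp: sol_quotient_def diff_divide_distrib)
  show ?thesis unfolding eq
    by (rule Lp_inf_lincomb[OF sol_Lp_inf[OF u(2)] sol_Lp_inf[OF u(1)]]) (use r in simp)
qed

lemma quotient_limit_exists:
  assumes u: "u \<in> U" "0 < c" "AE s in Y. c \<le> u s" and h: "h \<in> cone_at U u"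
  shows "\<exists>d. is_quotient_limit u h d"
proof -
  obtain t0 where t0: "0 < t0" "(\<lambda>y. u y + t0 * h y) \<in> U" using cone_segment[OF h] .
  have inU: "(\<lambda>y. u y + t * h y) \<in> U" if "0 < t" "t \<le> t0" for t
    by (rule U_segment[OF u(1) t0(2)]) (use that t0 in auto)
  have h': "AE s in Y. \<bar>h s\<bar> \<le> Linf_norm Y h" by (rule AE_le_Linf_norm[OF cone_Linf[OF u(1) h]])
  show ?thesis unfolding is_quotient_limit_def
  proof (rule bounded_antitone_quotient_limit[OF t0(1), where M = X and Q = "sol_quotient u h"])
    show "AE x in X. sol_quotient u h t x \<le> sol_quotient u h s x"
      if "0 < s" "s \<le> t" "t \<le> t0" for s t
      by (rule sol_quotient_antitone[OF u(1) inU]) (use that in auto)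
    show "sol_quotient u h t \<in> borel_measurable X" if "0 < t" "t \<le> t0" for t
      by (rule Lp_inf_measurable[OF sol_quotient_Lp_inf[OF u(1) inU[OF that]]])
    show "AE x in X. \<bar>sol_quotient u h t x\<bar> \<le> Linf_norm Y h / c * y u x"
      if "0 < t" "t \<le> t0" for t
      by (rule sol_quotient_bound[OF u that(1) inU[OF that] Linf_norm_nonneg h'])
  qed
qed

text \<open>Varying directions are harmless by the Lipschitz estimate, applied at \<open>u + \<tau>\<^sub>n h\<close>. For
large \<open>n\<close> this parameter is at least \<open>c / 2\<close> and its solution is at most \<open>2 y u\<close>, so the quotients for
\<open>h\<^sub>n\<close> and \<open>h\<close> differ by at most \<open>(4 / c) \<parallel>h\<^sub>n - h\<parallel> y u\<close>.\<close>

lemma quotient_limit_hadamard_AE: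
  assumes u: "u \<in> U" "0 < c" "AE s in Y. c \<le> u s" and h: "h \<in> cone_at U u"
    and d: "is_quotient_limit u h d"
    and \<tau>: "\<And>n::nat. 0 < \<tau> n" "\<tau> \<longlonglongrightarrow> 0" and hs: "tendsto_Linf Y hs h"
    and inU: "\<And>n. (\<lambda>s. u s + \<tau> n * hs n s) \<in> U"
  shows "AE x in X. (\<lambda>n. sol_quotient u (hs n) (\<tau> n) x) \<longlonglongrightarrow> d x"
proof -
  obtain t0 where t0: "0 < t0" "(\<lambda>y. u y + t0 * h y) \<in> U" using cone_segment[OF h] .
  define e where "e n = Linf_norm Y (\<lambda>s. hs n s - h s)" for n
  have e: "e \<longlonglongrightarrow> 0" "\<And>n. 0 \<le> e n"
    using hs by (auto simp: tendsto_Linf_def e_def[abs_def] Linf_norm_nonneg)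
  have e_AE: "AE s in Y. \<bar>hs n s - h s\<bar> \<le> e n" for n
  proof -
    have "(\<lambda>s. hs n s - h s) \<in> Linf Y"
      using Linf_lincomb[of "hs n" Y h 1 "-1"] hs by (simp add: tendsto_Linf_def)
    then show ?thesis unfolding e_def by (rule AE_le_Linf_norm)
  qed
  \<comment> \<open>Adding 1 makes the bound positive, so that it can be divided by.\<close>
  define H where "H = Linf_norm Y h + 1"
  have H: "0 < H" using Linf_norm_nonneg[of Y h] by (simp add: H_def)
  have H_AE: "AE s in Y. \<bar>h s\<bar> \<le> H"
    using AE_le_Linf_norm[OF cone_Linf[OF u(1) h]] by eventually_elim (simp add: H_def)
  have "\<forall>\<^sub>F n in sequentially. \<tau> n < min t0 (c / 2 / H)"
    by (rule order_tendstoD(2)[OF \<tau>(2)]) (use t0 u H in simp)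
  then obtain N where N: "\<And>n. N \<le> n \<Longrightarrow> \<tau> n < min t0 (c / 2 / H)"
    by (auto simp: eventually_sequentially)
  have diff: "AE x in X. \<bar>sol_quotient u (hs n) (\<tau> n) x - sol_quotient u h (\<tau> n) x\<bar>
      \<le> e n * (4 / c * y u x)" if n: "N \<le> n" for n
  proof -
    let ?w = "\<lambda>s. u s + \<tau> n * h s"
    have wU: "?w \<in> U"
      by (rule U_segment[OF u(1) t0(2)]) (use \<tau>(1)[of n] N[OF n] t0 in auto)
    have tH: "\<tau> n * H \<le> c / 2" using N[OF n] H by (simp add: pos_less_divide_eq)
    have w_ge: "AE s in Y. c / 2 \<le> ?w s"
      using u(3) H_AE
    proof eventually_elim
      case (elim s)
      have "\<tau> n * (- H) \<le> \<tau> n * h s"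
        using elim \<tau>(1)[of n] by (intro mult_left_mono) auto
      then show ?case using elim tH by simp
    qed
    have close: "AE s in Y. \<bar>(u s + \<tau> n * hs n s) - ?w s\<bar> \<le> \<tau> n * e n"
      using e_AE[of n]
    proof eventually_elim
      case (elim s)
      have "(u s + \<tau> n * hs n s) - ?w s = \<tau> n * (hs n s - h s)" by (simp add: algebra_simps)
      then show ?case using elim \<tau>(1)[of n] by (simp add: abs_mult)
    qed
    have 1: "AE x in X. \<bar>y (\<lambda>s. u s + \<tau> n * hs n s) x - y ?w x\<bar> \<le> \<tau> n * e n / (c / 2) * y ?w x"
      by (rule sol_lipschitz[OF wU _ w_ge inU _ close])
         (use u \<tau>(1)[of n] e(2)[of n] in auto)
    have 2: "AE x in X. \<bar>y ?w x - y u x\<bar> \<le> c / 2 / c * y u x"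
    proof (rule sol_lipschitz[OF u wU])
      show "AE s in Y. \<bar>?w s - u s\<bar> \<le> c / 2"
        using H_AE
      proof eventually_elim
        case (elim s)
        have "\<bar>?w s - u s\<bar> = \<tau> n * \<bar>h s\<bar>" using \<tau>(1)[of n] by (simp add: abs_mult)
        also have "\<dots> \<le> \<tau> n * H" using elim \<tau>(1)[of n] by (intro mult_left_mono) auto
        finally show ?case using tH by simp
      qed
    qed (use u in auto)
    from 1 2 sol_nonneg[OF u(1)] show ?thesis
    proof eventually_elim
      case (elim x)
      have "\<bar>y ?w x - y u x\<bar> \<le> 1 / 2 * y u x" using elim(2) u(2) by simp
      then have "y ?w x \<le> 2 * y u x" using elim(3) by linarith
      then have "\<tau> n * e n / (c / 2) * y ?w x \<le> \<tau> n * e n / (c / 2) * (2 * y u x)"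
        using u(2) \<tau>(1)[of n] e(2)[of n] by (intro mult_left_mono) auto
      also have "\<dots> = \<tau> n * (e n * (4 / c * y u x))" by simp
      finally have "\<bar>y (\<lambda>s. u s + \<tau> n * hs n s) x - y ?w x\<bar> \<le> \<tau> n * (e n * (4 / c * y u x))"
        using elim(1) by linarith
      then have "\<bar>y (\<lambda>s. u s + \<tau> n * hs n s) x - y ?w x\<bar> / \<tau> n \<le> e n * (4 / c * y u x)"
        using \<tau>(1)[of n] by (simp add: pos_divide_le_eq mult.commute)
      moreover have "sol_quotient u (hs n) (\<tau> n) x - sol_quotient u h (\<tau> n) x
          = (y (\<lambda>s. u s + \<tau> n * hs n s) x - y ?w x) / \<tau> n"
        by (simp add: sol_quotient_def diff_divide_distrib)
      ultimately show ?case using \<tau>(1)[of n] by (simp add: abs_divide)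
    qed
  qed
  have "AE x in X. \<forall>n. N \<le> n \<longrightarrow> \<bar>sol_quotient u (hs n) (\<tau> n) x - sol_quotient u h (\<tau> n) x\<bar>
      \<le> e n * (4 / c * y u x)"
    unfolding AE_all_countable using diff by auto
  moreover have "AE x in X. (\<lambda>n. sol_quotient u h (\<tau> n) x) \<longlonglongrightarrow> d x"
    by (rule quotient_limitD[OF d \<tau>])
  ultimately show ?thesis
  proof eventually_elim
    case (elim x)
    have "(\<lambda>n. sol_quotient u (hs n) (\<tau> n) x - sol_quotient u h (\<tau> n) x) \<longlonglongrightarrow> 0"
    proof (rule Lim_null_comparison)
      show "\<forall>\<^sub>F n in sequentially. norm (sol_quotient u (hs n) (\<tau> n) x - sol_quotient u h (\<tau> n) x)
          \<le> e n * (4 / c * y u x)"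
        unfolding eventually_sequentially using elim by auto
      show "(\<lambda>n. e n * (4 / c * y u x)) \<longlonglongrightarrow> 0" by (rule tendsto_mult_left_zero[OF e(1)])
    qed
    from tendsto_add[OF this elim(2)] show ?case by simp
  qed
qed

lemma quotient_limit_bound:
  assumes u: "u \<in> U" "0 < c" "AE s in Y. c \<le> u s" and h: "h \<in> cone_at U u"
    and d: "is_quotient_limit u h d"
  shows "AE x in X. \<bar>d x\<bar> \<le> Linf_norm Y h / c * y u x"
proof -
  obtain t0 where t0: "0 < t0" "(\<lambda>y. u y + t0 * h y) \<in> U" using cone_segment[OF h] .
  note \<tau> = null_steps[OF t0(1)]
  have inU: "(\<lambda>y. u y + t0 / real (Suc (Suc n)) * h y) \<in> U" for n
    by (rule U_segment[OF u(1) t0(2)]) (use \<tau>(1,2)[of n] t0 in auto)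
  show ?thesis
  proof (rule AE_limit_bound)
    show "AE x in X. \<bar>sol_quotient u h (t0 / real (Suc (Suc n))) x\<bar> \<le> Linf_norm Y h / c * y u x" for n
      by (rule sol_quotient_bound[OF u \<tau>(1) inU Linf_norm_nonneg
            AE_le_Linf_norm[OF cone_Linf[OF u(1) h]]])
    show "AE x in X. (\<lambda>n. sol_quotient u h (t0 / real (Suc (Suc n))) x) \<longlonglongrightarrow> d x"
      by (rule quotient_limitD[OF d \<tau>(1,3)])
  qed
qed

lemma quotient_limit_Lp_inf:
  assumes u: "u \<in> U" "0 < c" "AE s in Y. c \<le> u s" and h: "h \<in> cone_at U u"
    and d: "is_quotient_limit u h d"
  shows "d \<in> Lp_inf X r"
proof (rule Lp_inf_dominated)
  show "(\<lambda>x. Linf_norm Y h / c * y u x) \<in> Lp_inf X r"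
    using Lp_inf_lincomb[OF sol_Lp_inf[OF u(1)] sol_Lp_inf[OF u(1)], of "Linf_norm Y h / c" 0] r
    by simp
  show "d \<in> borel_measurable X" using d by (simp add: is_quotient_limit_def)
  show "AE x in X. \<bar>d x\<bar> \<le> \<bar>Linf_norm Y h / c * y u x\<bar>"
    using quotient_limit_bound[OF assms] by eventually_elim linarith
qed (use r in simp)

text \<open>All quotients are dominated by a multiple of \<open>y u\<close>, which belongs to \<open>L\<^sup>q\<close> for every \<open>q \<ge> r\<close> and
to \<open>L\<^sup>\<infinity>\<close>; a.e. convergence therefore yields both modes of convergence.\<close>

lemma quotient_limit_imp_hadamard:
  assumes u: "u \<in> U" "0 < c" "AE s in Y. c \<le> u s" and h: "h \<in> cone_at U u"
    and d: "is_quotient_limit u h d"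
  shows "is_hadamard_deriv X Y U r y u h d"
  unfolding is_hadamard_deriv_def
proof (intro conjI allI impI ballI)
  show dL: "d \<in> Lp_inf X r" by (rule quotient_limit_Lp_inf[OF assms])
  fix \<tau> :: "nat \<Rightarrow> real" and hs dn
  assume "(\<forall>n. 0 < \<tau> n) \<and> (\<forall>n. hs n \<in> cone_at U u) \<and> \<tau> \<longlonglongrightarrow> 0 \<and> tendsto_Linf Y hs h \<and>
    (\<forall>n. (\<lambda>s. u s + \<tau> n * hs n s) \<in> U) \<and>
    dn = (\<lambda>n x. (y (\<lambda>s. u s + \<tau> n * hs n s) x - y u x) / \<tau> n)"
  then have \<tau>: "\<And>n. 0 < \<tau> n" "\<tau> \<longlonglongrightarrow> 0" and hs: "tendsto_Linf Y hs h"
    and inU: "\<And>n. (\<lambda>s. u s + \<tau> n * hs n s) \<in> U"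
    and dn: "dn = (\<lambda>n. sol_quotient u (hs n) (\<tau> n))"
    unfolding sol_quotient_def by auto
  have lim: "AE x in X. (\<lambda>n. dn n x) \<longlonglongrightarrow> d x"
    unfolding dn by (rule quotient_limit_hadamard_AE[OF u h d \<tau> hs inU])
  have meas: "dn n \<in> borel_measurable X" for n
    unfolding dn by (rule Lp_inf_measurable[OF sol_quotient_Lp_inf[OF u(1) inU]])
  have "(\<lambda>n. Linf_norm Y (\<lambda>s. hs n s - h s)) \<longlonglongrightarrow> 0"
    using hs by (simp add: tendsto_Linf_def)
  then have "Bseq (\<lambda>n. Linf_norm Y (\<lambda>s. hs n s - h s))"
    by (intro convergent_imp_Bseq) (auto simp: convergent_def)
  then obtain B where B: "0 < B" "\<And>n. \<bar>Linf_norm Y (\<lambda>s. hs n s - h s)\<bar> \<le> B"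
    by (auto simp: Bseq_def)
  define K where "K = B + Linf_norm Y h"
  have K: "0 \<le> K" using B Linf_norm_nonneg[of Y h] by (simp add: K_def)
  have hsK: "AE s in Y. \<bar>hs n s\<bar> \<le> K" for n
  proof -
    have "(\<lambda>s. hs n s - h s) \<in> Linf Y"
      using Linf_lincomb[of "hs n" Y h 1 "-1"] hs by (simp add: tendsto_Linf_def)
    from AE_le_Linf_norm[OF this] AE_le_Linf_norm[OF cone_Linf[OF u(1) h]]
    show ?thesis
    proof eventually_elim
      case (elim s)
      then show ?case using B(2)[of n] unfolding K_def by linarith
    qed
  qed
  have bound: "AE x in X. \<bar>dn n x\<bar> \<le> K / c * y u x" for n
    unfolding dn by (rule sol_quotient_bound[OF u \<tau>(1) inU K hsK])
  have G: "(\<lambda>x. K / c * y u x) \<in> Lp_inf X r"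
    using Lp_inf_lincomb[OF sol_Lp_inf[OF u(1)] sol_Lp_inf[OF u(1)], of "K / c" 0] r by simp
  show "tendsto_Lp X q dn d" if "r \<le> q" for q
    by (rule tendsto_Lp_dominated[OF _ meas Lp_inf_measurable[OF dL] Lp_inf_imp_Lp[OF G that] bound lim])
       (use r that in simp)
  obtain M where M: "AE x in X. \<bar>K / c * y u x\<bar> \<le> M" using Lp_inf_bounded[OF G] by blast
  have dbound: "AE x in X. \<bar>d x\<bar> \<le> K / c * y u x" by (rule AE_limit_bound[OF bound lim])
  show "(\<lambda>n. \<integral>x. z x * (dn n x - d x) \<partial>X) \<longlonglongrightarrow> 0" if "z \<in> Lp X 1" for z
  proof (rule weak_star_dominated[OF that])
    show "(\<lambda>x. dn n x - d x) \<in> borel_measurable X" for n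
      using meas Lp_inf_measurable[OF dL] by measurable
    show "AE x in X. \<bar>dn n x - d x\<bar> \<le> 2 * M" for n
      using bound[of n] dbound M by eventually_elim linarith
    show "AE x in X. (\<lambda>n. dn n x - d x) \<longlonglongrightarrow> 0"
      using lim by eventually_elim (rule LIM_zero)
  qed
qed

lemma hadamard_derivD:
  assumes d: "is_hadamard_deriv X Y U r y u h d" and h: "h \<in> cone_at U u"
    and \<tau>: "\<And>n. 0 < \<tau> n" "\<tau> \<longlonglongrightarrow> 0" "tendsto_Linf Y (\<lambda>_. h) h"
    and inU: "\<And>n. (\<lambda>s. u s + \<tau> n * h s) \<in> U"
  shows "tendsto_Lp X r (\<lambda>n. sol_quotient u h (\<tau> n)) d"
proof -
  have "\<forall>(\<tau>::nat \<Rightarrow> real) hs dn.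
      (\<forall>n. 0 < \<tau> n) \<and> (\<forall>n. hs n \<in> cone_at U u) \<and> \<tau> \<longlonglongrightarrow> 0 \<and> tendsto_Linf Y hs h \<and>
      (\<forall>n. (\<lambda>y. u y + \<tau> n * hs n y) \<in> U) \<and>
      dn = (\<lambda>n x. (y (\<lambda>y. u y + \<tau> n * hs n y) x - y u x) / \<tau> n) \<longrightarrow> (\<forall>q\<ge>r. tendsto_Lp X q dn d)"
    using d unfolding is_hadamard_deriv_def by blast
  from this[rule_format, of \<tau> "\<lambda>_. h" "\<lambda>n. sol_quotient u h (\<tau> n)" r]
  show ?thesis using \<tau> h inU by (simp add: sol_quotient_def[abs_def])
qed

lemma hadamard_iff:
  assumes u: "u \<in> U" "0 < c" "AE s in Y. c \<le> u s" and h: "h \<in> cone_at U u"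
    and d: "is_quotient_limit u h d"
  shows "is_hadamard_deriv X Y U r y u h d' \<longleftrightarrow> d' \<in> Lp_inf X r \<and> eq_ae X d' d"
proof
  assume d': "is_hadamard_deriv X Y U r y u h d'"
  obtain t0 where t0: "0 < t0" "(\<lambda>y. u y + t0 * h y) \<in> U" using cone_segment[OF h] .
  note \<tau> = null_steps[OF t0(1)]
  let ?\<tau> = "\<lambda>n. t0 / real (Suc (Suc n))"
  have inU: "(\<lambda>y. u y + ?\<tau> n * h y) \<in> U" for n
    by (rule U_segment[OF u(1) t0(2)]) (use \<tau>(1,2)[of n] t0 in auto)
  have "tendsto_Linf Y (\<lambda>_. h) h"
    using cone_Linf[OF u(1) h] Linf_norm_le[of "\<lambda>_. 0" Y 0] Linf_norm_nonneg[of Y "\<lambda>_. 0"]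
    by (simp add: tendsto_Linf_def)
  then have "tendsto_Lp X r (\<lambda>n. sol_quotient u h (?\<tau> n)) d'"
    by (rule hadamard_derivD[OF d' h \<tau>(1,3) _ inU])
  moreover have "AE x in X. (\<lambda>n. sol_quotient u h (?\<tau> n) x) \<longlonglongrightarrow> d x"
    by (rule quotient_limitD[OF d \<tau>(1,3)])
  moreover have "0 < r" using r by simp
  ultimately have "eq_ae X d' d" using tendsto_Lp_limit_unique by blast
  then show "d' \<in> Lp_inf X r \<and> eq_ae X d' d" using d' by (simp add: is_hadamard_deriv_def)
next
  assume d': "d' \<in> Lp_inf X r \<and> eq_ae X d' d"
  have "is_quotient_limit u h d'"
    unfolding is_quotient_limit_def
  proof (intro conjI allI impI)
    show "d' \<in> borel_measurable X" using d' Lp_inf_measurable by blast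
    fix \<tau> :: "nat \<Rightarrow> real" assume "(\<forall>n. 0 < \<tau> n) \<and> \<tau> \<longlonglongrightarrow> 0"
    then have "AE x in X. (\<lambda>n. sol_quotient u h (\<tau> n) x) \<longlonglongrightarrow> d x"
      using quotient_limitD[OF d] by blast
    then show "AE x in X. (\<lambda>n. sol_quotient u h (\<tau> n) x) \<longlonglongrightarrow> d' x"
      using conjunct2[OF d'] by eventually_elim simp
  qed
  then show "is_hadamard_deriv X Y U r y u h d'" by (rule quotient_limit_imp_hadamard[OF u h])
qed

end

context concave_fixed_point
begin

section \<open>The characterization by supersolutions\<close>

abbreviation "DPsi u h \<zeta> \<equiv> Psi_deriv X U S \<Phi> (y u) u \<zeta> h"

text \<open>The witnesses are the quotients \<open>\<zeta>\<^sub>n\<close> themselves: \<open>y u + \<tau>\<^sub>n \<zeta>\<^sub>n\<close> is the solution for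
\<open>u + \<tau>\<^sub>n h\<close>, in particular a supersolution. The residual is controlled by
\<open>\<zeta>\<^sub>n \<le> \<Psi>'(\<zeta>\<^sub>n) \<le> d\<close>. The first inequality holds because \<open>\<zeta>\<^sub>n\<close> is also the quotient of \<open>\<Psi>\<close> in
direction \<open>\<zeta>\<^sub>n\<close> with step \<open>\<tau>\<^sub>n\<close>. For the second, the quotient with step
\<open>\<tau>\<^sub>k\<close>, \<open>k \<ge> n\<close>, is at most the one in the larger direction \<open>\<zeta>\<^sub>k\<close>, which equals \<open>\<zeta>\<^sub>k\<close>.\<close>

lemma quotient_limit_in_A_set:
  assumes u: "u \<in> U" "0 < c" "AE s in Y. c \<le> u s" and h: "h \<in> cone_at U u"
    and d: "is_quotient_limit u h d" and t0: "0 < t0" "(\<lambda>y. u y + t0 * h y) \<in> U"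
  shows "d \<in> A_set X U S \<Phi> r u h t0"
proof -
  define \<tau> where "\<tau> n = t0 / real (Suc (Suc n))" for n
  have \<tau>: "0 < \<tau> n" "\<tau> n < t0" "\<tau> \<longlonglongrightarrow> 0" "m \<le> n \<Longrightarrow> \<tau> n \<le> \<tau> m" for m n
    unfolding \<tau>_def[abs_def] by (rule null_steps[OF t0(1)])+
  define \<zeta> where "\<zeta> n = sol_quotient u h (\<tau> n)" for n
  have inU: "(\<lambda>y. u y + \<tau> n * h y) \<in> U" for n
    by (rule U_segment[OF u(1) t0(2)]) (use \<tau>(1,2)[of n] t0 in auto)
  have \<zeta>L: "\<zeta> n \<in> Lp_inf X r" for n
    unfolding \<zeta>_def by (rule sol_quotient_Lp_inf[OF u(1) inU])
  then have \<zeta>L2: "\<zeta> n \<in> Lp_inf X 2" for n using Lp_inf_mono[OF r(2)] by blast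
  have \<zeta>_mono: "le_ae X (\<zeta> m) (\<zeta> n)" if "m \<le> n" for m n
    unfolding \<zeta>_def by (rule sol_quotient_antitone[OF u(1) inU \<tau>(1) \<tau>(4)[OF that]])
  have point: "(\<lambda>x. y u x + \<tau> n * \<zeta> n x) = y (\<lambda>s. u s + \<tau> n * h s)" for n
    using \<tau>(1)[of n] by (auto simp: \<zeta>_def sol_quotient_def)
  have lim: "AE x in X. (\<lambda>n. \<zeta> n x) \<longlonglongrightarrow> d x"
    unfolding \<zeta>_def by (rule quotient_limitD[OF d \<tau>(1,3)])
  have dL: "d \<in> Lp_inf X r" by (rule quotient_limit_Lp_inf[OF u h d])
  have G: "(\<lambda>x. Linf_norm Y h / c * y u x) \<in> Lp_inf X r"
    using Lp_inf_lincomb[OF sol_Lp_inf[OF u(1)] sol_Lp_inf[OF u(1)], of "Linf_norm Y h / c" 0] r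
    by simp
  have conv: "tendsto_Lp X q \<zeta> d" if "r \<le> q" for q
  proof (rule tendsto_Lp_dominated[OF _ Lp_inf_measurable[OF \<zeta>L] Lp_inf_measurable[OF dL]
        Lp_inf_imp_Lp[OF G that] _ lim])
    show "AE x in X. \<bar>\<zeta> n x\<bar> \<le> Linf_norm Y h / c * y u x" for n
      unfolding \<zeta>_def by (rule sol_quotient_bound[OF u \<tau>(1) inU Linf_norm_nonneg
          AE_le_Linf_norm[OF cone_Linf[OF u(1) h]]])
  qed (use r that in simp)
  have super: "is_supersolution X S \<Phi> (\<lambda>y. u y + \<tau> n * h y) (\<lambda>x. y u x + \<tau> n * \<zeta> n x)" for n
    unfolding point is_supersolution_def
    using sol_Lp_2[OF inU[of n]] sol_fixed[OF inU[of n]] by (auto simp: Psi_def elim!: AE_mp)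
  have lower: "AE x in X. ereal (\<zeta> n x) \<le> DPsi u h (\<zeta> n) x" for n
  proof -
    have ge: "AE x in X. - \<epsilon> \<le> y u x + \<tau> n * \<zeta> n x"
      using sol_nonneg[OF inU[of n]] unfolding point[of n, THEN fun_cong]
      by eventually_elim (use eps in simp)
    have quot: "T_quotient (y u) u (\<zeta> n) h (\<tau> n) x
        = (T (y (\<lambda>s. u s + \<tau> n * h s)) (\<lambda>s. u s + \<tau> n * h s) x - T (y u) u x) / \<tau> n" for x
      by (simp only: T_quotient_def point)
    show ?thesis
      using T_quotient_le_Psi_deriv[OF sol_Lp_2[OF u(1)] sol_nonneg[OF u(1)] u(1) \<zeta>L2 ge \<tau>(1) inU h]
        sol_fixed[OF inU[of n]] sol_fixed[OF u(1)]
    proof eventually_elim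
      case (elim x)
      have "\<zeta> n x = T_quotient (y u) u (\<zeta> n) h (\<tau> n) x"
        unfolding quot elim(2,3)[symmetric] by (simp only: \<zeta>_def sol_quotient_def)
      then show ?case using elim(1) by simp
    qed
  qed
  have upper: "AE x in X. DPsi u h (\<zeta> n) x \<le> ereal (d x)" for n
  proof -
    have "AE x in X. T_quotient (y u) u (\<zeta> n) h (\<tau> k) x \<le> \<zeta> k x" if "n \<le> k" for k
    proof -
      have 1: "(\<lambda>x. y u x + \<tau> k * \<zeta> n x) \<in> Lp X 2"
        using Lp_lincomb[OF sol_Lp_2[OF u(1)], of "\<zeta> n" 1 "\<tau> k"] \<zeta>L2[of n] by (simp add: Lp_inf_def)
      have 2: "le_ae X (\<lambda>x. y u x + \<tau> k * \<zeta> n x) (y (\<lambda>s. u s + \<tau> k * h s))"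
        unfolding point[symmetric] using \<zeta>_mono[OF that]
        by eventually_elim (intro add_left_mono mult_left_mono less_imp_le[OF \<tau>(1)])
      from T_mono[OF 1 sol_Lp_2[OF inU[of k]] inU[of k] 2] sol_fixed[OF inU[of k]] sol_fixed[OF u(1)]
      show ?thesis
      proof eventually_elim
        case (elim x)
        then show ?case unfolding T_quotient_def \<zeta>_def sol_quotient_def
          by (intro divide_right_mono less_imp_le[OF \<tau>(1)]) simp
      qed
    qed
    then have "AE x in X. \<forall>k. n \<le> k \<longrightarrow> T_quotient (y u) u (\<zeta> n) h (\<tau> k) x \<le> \<zeta> k x"
      unfolding AE_all_countable by auto
    then show ?thesis
      using lim Psi_deriv_limit[OF sol_Lp_2[OF u(1)] sol_nonneg[OF u(1)] u(1) \<zeta>L2[of n] h \<tau>(1,3)]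
    proof eventually_elim
      case (elim x)
      show ?case
      proof (rule LIMSEQ_le[OF elim(3)])
        show "(\<lambda>k. ereal (\<zeta> k x)) \<longlonglongrightarrow> ereal (d x)" using elim(2) by simp
        show "\<exists>N. \<forall>k\<ge>N. ereal (T_quotient (y u) u (\<zeta> n) h (\<tau> k) x) \<le> ereal (\<zeta> k x)"
          using elim(1) by auto
      qed
    qed
  qed
  have "AE x in X. \<forall>n. ereal (\<zeta> n x) \<le> DPsi u h (\<zeta> n) x \<and> DPsi u h (\<zeta> n) x \<le> ereal (d x)"
    unfolding AE_all_countable using lower upper by (auto intro: AE_conjI)
  then have resid: "AE x in X. (\<lambda>n. DPsi u h (\<zeta> n) x - ereal (\<zeta> n x)) \<longlonglongrightarrow> 0"
    using lim
  proof eventually_elim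
    case (elim x)
    have "0 \<le> DPsi u h (\<zeta> n) x - ereal (\<zeta> n x) \<and>
        DPsi u h (\<zeta> n) x - ereal (\<zeta> n x) \<le> ereal (d x - \<zeta> n x)" for n
      using elim(1)[rule_format, of n] by (cases "DPsi u h (\<zeta> n) x") auto
    then have *: "\<And>n. 0 \<le> DPsi u h (\<zeta> n) x - ereal (\<zeta> n x)"
      "\<And>n. DPsi u h (\<zeta> n) x - ereal (\<zeta> n x) \<le> ereal (d x - \<zeta> n x)" by auto
    have "(\<lambda>n. d x - \<zeta> n x) \<longlonglongrightarrow> d x - d x" by (intro tendsto_intros elim(2))
    then have "(\<lambda>n. ereal (d x - \<zeta> n x)) \<longlonglongrightarrow> 0" by (simp add: zero_ereal_def)
    then show ?case
      by (rule tendsto_sandwich[OF _ _ tendsto_const, rotated 2]) (use * in auto)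
  qed
  show ?thesis unfolding A_set_def
  proof (intro CollectI conjI exI)
    show "\<forall>n. le_ae X (\<zeta> n) (\<zeta> (Suc n)) \<and> \<tau> (Suc n) \<le> \<tau> n"
      using \<zeta>_mono \<tau>(4) by simp
    show "\<forall>q\<ge>r. tendsto_Lp X q \<zeta> d" using conv by blast
  qed (use dL \<zeta>L \<tau> super resid in auto)
qed

text \<open>By the comparison principle a supersolution \<open>y u + \<tau>\<^sub>n \<zeta>\<^sub>n\<close> lies above the solution, so
\<open>\<zeta>\<^sub>n\<close> lies above the difference quotient with step \<open>\<tau>\<^sub>n\<close>.\<close>

lemma quotient_limit_le_A_set:
  assumes u: "u \<in> U" and d: "is_quotient_limit u h d"
    and t0: "0 < t0" "(\<lambda>y. u y + t0 * h y) \<in> U" and \<zeta>: "\<zeta> \<in> A_set X U S \<Phi> r u h t0"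
  shows "le_ae X d \<zeta>"
proof -
  obtain \<zeta>s and \<tau> :: "nat \<Rightarrow> real" where \<tau>: "\<And>n. 0 < \<tau> n" "\<And>n. \<tau> n < t0" "\<tau> \<longlonglongrightarrow> 0"
    and mono: "\<And>n. le_ae X (\<zeta>s n) (\<zeta>s (Suc n))" and conv: "tendsto_Lp X r \<zeta>s \<zeta>"
    and super: "\<And>n. is_supersolution X S \<Phi> (\<lambda>y. u y + \<tau> n * h y) (\<lambda>x. y u x + \<tau> n * \<zeta>s n x)"
    using \<zeta> unfolding A_set_def by blast
  have inU: "(\<lambda>y. u y + \<tau> n * h y) \<in> U" for n
    by (rule U_segment[OF u t0(2)]) (use \<tau>(1,2)[of n] t0 in auto)
  have "AE x in X. sol_quotient u h (\<tau> n) x \<le> \<zeta>s n x" for n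
  proof -
    have "le_ae X (y (\<lambda>s. u s + \<tau> n * h s)) (\<lambda>x. y u x + \<tau> n * \<zeta>s n x)"
      by (rule sol_le_supersolution[OF inU])
         (use super[of n] in \<open>auto simp: is_supersolution_def Psi_def\<close>)
    then show ?thesis unfolding sol_quotient_def
      by eventually_elim (use \<tau>(1)[of n] in \<open>simp add: pos_divide_le_eq algebra_simps\<close>)
  qed
  then have "AE x in X. \<forall>n. sol_quotient u h (\<tau> n) x \<le> \<zeta>s n x"
    unfolding AE_all_countable by blast
  moreover have "AE x in X. incseq (\<lambda>n. \<zeta>s n x) \<and> (\<lambda>n. \<zeta>s n x) \<longlonglongrightarrow> \<zeta> x"
    by (rule tendsto_Lp_incseq_AE[OF _ conv mono]) (use r in simp)
  ultimately show ?thesis using quotient_limitD[OF d \<tau>(1,3)]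
  proof eventually_elim
    case (elim x)
    show ?case by (rule LIMSEQ_le[OF elim(3) conjunct2[OF elim(2)]]) (use elim(1) in auto)
  qed
qed

lemma A_set_closed_AE:
  assumes \<zeta>: "\<zeta> \<in> A_set X U S \<Phi> r u h t0" and \<zeta>': "\<zeta>' \<in> Lp_inf X r" "eq_ae X \<zeta> \<zeta>'"
  shows "\<zeta>' \<in> A_set X U S \<Phi> r u h t0"
proof -
  have "tendsto_Lp X q f \<zeta>'" if "r \<le> q" "tendsto_Lp X q f \<zeta>" for q f
    using tendsto_Lp_cong_limit[OF that(2) \<zeta>'(2) Lp_inf_imp_Lp[OF \<zeta>'(1) that(1)]] .
  then show ?thesis using \<zeta> \<zeta>'(1) unfolding A_set_def by blast
qed

lemma hadamard_iff_smallest: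
  assumes u: "u \<in> U" "0 < c" "AE s in Y. c \<le> u s" and h: "h \<in> cone_at U u"
    and t0: "0 < t0" "(\<lambda>y. u y + t0 * h y) \<in> U"
  shows "is_hadamard_deriv X Y U r y u h \<delta> \<longleftrightarrow> smallest_ae X (A_set X U S \<Phi> r u h t0) \<delta>"
proof -
  obtain d where d: "is_quotient_limit u h d" using quotient_limit_exists[OF u h] by blast
  note iff = hadamard_iff[OF u h d]
  note dA = quotient_limit_in_A_set[OF u h d t0]
  note dmin = quotient_limit_le_A_set[OF u(1) d t0]
  show ?thesis
  proof
    assume "is_hadamard_deriv X Y U r y u h \<delta>"
    then have \<delta>: "\<delta> \<in> Lp_inf X r" "eq_ae X \<delta> d" using iff by auto
    have "\<delta> \<in> A_set X U S \<Phi> r u h t0"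
      by (rule A_set_closed_AE[OF dA \<delta>(1)]) (use \<delta>(2) in \<open>auto elim!: AE_mp\<close>)
    moreover have "le_ae X \<delta> z" if "z \<in> A_set X U S \<Phi> r u h t0" for z
      using dmin[OF that] \<delta>(2) by eventually_elim simp
    ultimately show "smallest_ae X (A_set X U S \<Phi> r u h t0) \<delta>" by (simp add: smallest_ae_def)
  next
    assume "smallest_ae X (A_set X U S \<Phi> r u h t0) \<delta>"
    then have \<delta>: "\<delta> \<in> A_set X U S \<Phi> r u h t0" "le_ae X \<delta> d"
      using dA by (auto simp: smallest_ae_def)
    have "eq_ae X \<delta> d" using dmin[OF \<delta>(1)] \<delta>(2) by eventually_elim simp
    moreover have "\<delta> \<in> Lp_inf X r" using \<delta>(1) by (simp add: A_set_def)
    ultimately show "is_hadamard_deriv X Y U r y u h \<delta>" using iff by blast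
  qed
qed

text \<open>A constant sequence suffices: the quotients of \<open>\<Psi>\<close> in direction \<open>\<zeta>\<close> lie below
\<open>\<Psi>'(\<zeta>) = \<zeta>\<close>, and for small steps this says that \<open>y u + \<tau> \<zeta>\<close> is a supersolution.\<close>

lemma B_set_subset_A_set:
  assumes u: "u \<in> U" and h: "h \<in> cone_at U u" and t0: "0 < t0" "(\<lambda>y. u y + t0 * h y) \<in> U"
  shows "B_set X U S \<Phi> r u h \<subseteq> A_set X U S \<Phi> r u h t0"
proof
  fix \<zeta> assume "\<zeta> \<in> B_set X U S \<Phi> r u h"
  then have \<zeta>: "\<zeta> \<in> Lp_inf X r" "AE x in X. ereal (\<zeta> x) = DPsi u h \<zeta> x"
    by (auto simp: B_set_def)
  have \<zeta>L2: "\<zeta> \<in> Lp_inf X 2" using \<zeta>(1) Lp_inf_mono[OF r(2)] by blast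
  obtain t1 where t1: "0 < t1" "t1 \<le> t0"
    and ge: "\<And>t g. 0 \<le> t \<Longrightarrow> t \<le> t1 \<Longrightarrow> le_ae X \<zeta> g \<Longrightarrow> AE x in X. - \<epsilon> \<le> y u x + t * g x"
    using small_step[OF \<zeta>(1) t0(1) sol_nonneg[OF u]] by blast
  define \<tau> where "\<tau> n = t1 / real (Suc (Suc n))" for n
  have \<tau>: "0 < \<tau> n" "\<tau> n < t1" "\<tau> \<longlonglongrightarrow> 0" "m \<le> n \<Longrightarrow> \<tau> n \<le> \<tau> m" for m n
    unfolding \<tau>_def[abs_def] by (rule null_steps[OF t1(1)])+
  have \<tau>0: "\<tau> n < t0" for n using \<tau>(2)[of n] t1 by simp
  have super: "is_supersolution X S \<Phi> (\<lambda>y. u y + \<tau> n * h y) (\<lambda>x. y u x + \<tau> n * \<zeta> x)" for n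
    unfolding is_supersolution_def
  proof
    show "(\<lambda>x. y u x + \<tau> n * \<zeta> x) \<in> Lp X 2"
      using Lp_lincomb[OF sol_Lp_2[OF u], of \<zeta> 1 "\<tau> n"] \<zeta>L2 by (simp add: Lp_inf_def)
    have inU: "(\<lambda>y. u y + \<tau> n * h y) \<in> U"
      by (rule U_segment[OF u t0(2)]) (use \<tau>(1)[of n] \<tau>0[of n] t0 in auto)
    have ge': "AE x in X. - \<epsilon> \<le> y u x + \<tau> n * \<zeta> x"
      by (rule ge) (use \<tau>(1,2)[of n] in auto)
    from T_quotient_le_Psi_deriv[OF sol_Lp_2[OF u] sol_nonneg[OF u] u \<zeta>L2 ge' \<tau>(1) inU h]
      \<zeta>(2) sol_fixed[OF u]
    have "le_ae X (T (\<lambda>x. y u x + \<tau> n * \<zeta> x) (\<lambda>y. u y + \<tau> n * h y)) (\<lambda>x. y u x + \<tau> n * \<zeta> x)"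
    proof eventually_elim
      case (elim x)
      then have "T_quotient (y u) u \<zeta> h (\<tau> n) x \<le> \<zeta> x" by (metis ereal_less_eq(3))
      then show ?case using \<tau>(1)[of n] elim(3)
        by (simp add: T_quotient_def pos_divide_le_eq algebra_simps)
    qed
    then show "le_ae X (S (Some (\<Phi> (\<lambda>x. y u x + \<tau> n * \<zeta> x))) (\<lambda>y. u y + \<tau> n * h y))
        (\<lambda>x. y u x + \<tau> n * \<zeta> x)" by (simp add: Psi_def)
  qed
  have conv: "tendsto_Lp X q (\<lambda>_. \<zeta>) \<zeta>" if "r \<le> q" for q
    by (rule tendsto_Lp_dominated[OF _ Lp_inf_measurable[OF \<zeta>(1)] Lp_inf_measurable[OF \<zeta>(1)],
          where G = "\<lambda>x. \<bar>\<zeta> x\<bar>"])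
       (use r that \<zeta>(1) Lp_inf_imp_Lp[OF \<zeta>(1) that] in \<open>auto simp: Lp_def\<close>)
  have resid: "AE x in X. (\<lambda>n::nat. DPsi u h \<zeta> x - ereal (\<zeta> x)) \<longlonglongrightarrow> 0"
    using \<zeta>(2)
  proof eventually_elim
    case (elim x)
    show ?case unfolding elim[symmetric] by simp
  qed
  show "\<zeta> \<in> A_set X U S \<Phi> r u h t0" unfolding A_set_def
  proof (intro CollectI conjI exI)
    show "\<forall>n::nat. \<zeta> \<in> Lp_inf X r" using \<zeta>(1) by simp
    show "\<forall>n. 0 < \<tau> n \<and> \<tau> n < t0" using \<tau>(1) \<tau>0 by simp
    show "\<forall>n. le_ae X \<zeta> \<zeta> \<and> \<tau> (Suc n) \<le> \<tau> n" using \<tau>(4) by simp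
    show "\<forall>q\<ge>r. tendsto_Lp X q (\<lambda>_. \<zeta>) \<zeta>" using conv by blast
    show "AE x in X. (\<lambda>n::nat. DPsi u h \<zeta> x - ereal (\<zeta> x)) \<longlonglongrightarrow> 0" by (rule resid)
  qed (use \<zeta>(1) \<tau>(3) super in auto)
qed

text \<open>The inequality \<open>\<zeta> \<le> \<Psi>'(\<zeta>)\<close> follows from \<open>\<Psi>'(\<zeta>\<^sub>n) \<le> \<Psi>'(\<zeta>)\<close> and
\<open>\<Psi>'(\<zeta>\<^sub>n) \<longlonglongrightarrow> \<zeta>\<close>. For the converse, fix a step \<open>t\<close>. Semicontinuity along \<open>y u + t \<zeta>\<^sub>n\<close> bounds the
quotient in direction \<open>\<zeta>\<close> by the upper limit of the quotients in the directions \<open>\<zeta>\<^sub>n\<close>, and these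
lie below \<open>\<Psi>'(\<zeta>\<^sub>n)\<close>. The step is fixed before \<open>n\<close> tends to infinity, so it must be
admissible for all \<open>\<zeta>\<^sub>n\<close> at once; \<open>\<zeta>\<^sub>n \<ge> \<zeta>\<^sub>0\<close> ensures this.\<close>

lemma A_set_subset_B_set:
  assumes u: "u \<in> U" and h: "h \<in> cone_at U u" and t0: "0 < t0" "(\<lambda>y. u y + t0 * h y) \<in> U"
    and semi: "Psi_semicontinuous X U S \<Phi> r"
  shows "A_set X U S \<Phi> r u h t0 \<subseteq> B_set X U S \<Phi> r u h"
proof
  fix \<zeta> assume "\<zeta> \<in> A_set X U S \<Phi> r u h t0"
  then obtain \<zeta>s where \<zeta>: "\<zeta> \<in> Lp_inf X r" and \<zeta>s: "\<And>n. \<zeta>s n \<in> Lp_inf X r"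
    and mono: "\<And>n. le_ae X (\<zeta>s n) (\<zeta>s (Suc n))" and conv: "tendsto_Lp X r \<zeta>s \<zeta>"
    and resid: "AE x in X. (\<lambda>n. DPsi u h (\<zeta>s n) x - ereal (\<zeta>s n x)) \<longlonglongrightarrow> 0"
    unfolding A_set_def by blast
  have L2: "f \<in> Lp_inf X 2" if "f \<in> Lp_inf X r" for f using that Lp_inf_mono[OF r(2)] by blast
  have inc: "AE x in X. incseq (\<lambda>n. \<zeta>s n x) \<and> (\<lambda>n. \<zeta>s n x) \<longlonglongrightarrow> \<zeta> x"
    by (rule tendsto_Lp_incseq_AE[OF _ conv mono]) (use r in simp)
  have between: "AE x in X. \<zeta>s 0 x \<le> \<zeta>s n x \<and> \<zeta>s n x \<le> \<zeta> x" for n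
    using inc by eventually_elim (auto intro: incseq_le dest: incseqD)
  have D_lim: "AE x in X. (\<lambda>n. DPsi u h (\<zeta>s n) x) \<longlonglongrightarrow> ereal (\<zeta> x)"
    using inc resid
  proof eventually_elim
    case (elim x)
    have "(\<lambda>n. ereal (\<zeta>s n x)) \<longlonglongrightarrow> ereal (\<zeta> x)" using elim(1) by simp
    then have "(\<lambda>n. (DPsi u h (\<zeta>s n) x - ereal (\<zeta>s n x)) + ereal (\<zeta>s n x)) \<longlonglongrightarrow> 0 + ereal (\<zeta> x)"
      using elim(2) by (intro tendsto_add_ereal) auto
    moreover have "(DPsi u h (\<zeta>s n) x - ereal (\<zeta>s n x)) + ereal (\<zeta>s n x) = DPsi u h (\<zeta>s n) x" for n
      by (cases "DPsi u h (\<zeta>s n) x") auto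
    ultimately show ?case by simp
  qed
  have lower: "AE x in X. ereal (\<zeta> x) \<le> DPsi u h \<zeta> x"
  proof -
    have "AE x in X. DPsi u h (\<zeta>s n) x \<le> DPsi u h \<zeta> x" for n
      by (rule Psi_deriv_mono[OF sol_Lp_2[OF u] sol_nonneg[OF u] u L2[OF \<zeta>s] L2[OF \<zeta>] _ h])
         (use between[of n] in \<open>auto elim!: AE_mp\<close>)
    then have "AE x in X. \<forall>n. DPsi u h (\<zeta>s n) x \<le> DPsi u h \<zeta> x"
      unfolding AE_all_countable by blast
    then show ?thesis using D_lim
    proof eventually_elim
      case (elim x)
      show ?case by (rule LIMSEQ_le_const2[OF elim(2)]) (use elim(1) in auto)
    qed
  qed
  obtain t1 where t1: "0 < t1" "t1 \<le> t0"
    and ge: "\<And>t g. 0 \<le> t \<Longrightarrow> t \<le> t1 \<Longrightarrow> le_ae X (\<zeta>s 0) g \<Longrightarrow> AE x in X. - \<epsilon> \<le> y u x + t * g x"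
    using small_step[OF \<zeta>s[of 0] t0(1) sol_nonneg[OF u]] by blast
  have quotient_le: "AE x in X. T_quotient (y u) u \<zeta> h t x \<le> \<zeta> x" if t: "0 < t" "t \<le> t1" for t
  proof -
    let ?w = "\<lambda>y. u y + t * h y"
    have wU: "?w \<in> U"
      by (rule U_segment[OF u t0(2)]) (use t t1 t0 in auto)
    define z where "z n x = y u x + t * \<zeta>s n x" for n x
    have zL: "z n \<in> Lp_inf X r" for n
      using Lp_inf_lincomb[OF sol_Lp_inf[OF u] \<zeta>s, of 1 t n] r by (simp add: z_def[abs_def])
    define g where "g x = y u x + t * (\<bar>\<zeta>s 0 x\<bar> + \<bar>\<zeta> x\<bar>)" for x
    have gL: "g \<in> Lp_inf X r"
    proof -
      have abs: "(\<lambda>x. \<bar>f x\<bar>) \<in> Lp_inf X r" if "f \<in> Lp_inf X r" for f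
        by (rule Lp_inf_dominated[OF that]) (use Lp_inf_measurable[OF that] r in auto)
      have "(\<lambda>x. \<bar>\<zeta>s 0 x\<bar> + \<bar>\<zeta> x\<bar>) \<in> Lp_inf X r"
        using Lp_inf_lincomb[OF abs[OF \<zeta>s[of 0]] abs[OF \<zeta>], of 1 1] r by simp
      then show ?thesis
        using Lp_inf_lincomb[OF sol_Lp_inf[OF u], of "\<lambda>x. \<bar>\<zeta>s 0 x\<bar> + \<bar>\<zeta> x\<bar>" 1 t] r
        by (simp add: g_def[abs_def])
    qed
    have z_le: "AE x in X. \<bar>z n x\<bar> \<le> g x" for n
      using between[of n] sol_nonneg[OF u]
    proof eventually_elim
      case (elim x)
      have "\<bar>\<zeta>s n x\<bar> \<le> \<bar>\<zeta>s 0 x\<bar> + \<bar>\<zeta> x\<bar>" using elim by linarith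
      then have "\<bar>t * \<zeta>s n x\<bar> \<le> t * (\<bar>\<zeta>s 0 x\<bar> + \<bar>\<zeta> x\<bar>)"
        using t by (simp add: abs_mult)
      then show ?case using elim(2) unfolding z_def g_def by linarith
    qed
    have norm: "Lp_inf_norm X r (z n) \<le> Lp_inf_norm X r g" for n
    proof -
      have le: "AE x in X. \<bar>z n x\<bar> \<le> \<bar>g x\<bar>" using z_le[of n] by eventually_elim linarith
      have "Lp_norm X r (z n) \<le> Lp_norm X r g"
        by (rule Lp_norm_mono[OF _ Lp_inf_measurable[OF zL] _ le]) (use gL r in \<open>auto simp: Lp_inf_def\<close>)
      moreover have "Linf_norm X (z n) \<le> Linf_norm X g"
      proof (rule Linf_norm_le[OF Lp_inf_measurable[OF zL] Linf_norm_nonneg])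
        have "g \<in> Linf X" using gL by (simp add: Lp_inf_def)
        from AE_le_Linf_norm[OF this] le show "AE x in X. \<bar>z n x\<bar> \<le> Linf_norm X g"
          by eventually_elim linarith
      qed
      ultimately show ?thesis by (simp add: Lp_inf_norm_def)
    qed
    have z_mono: "le_ae X (z n) (z (Suc n))" for n
      using mono[of n] unfolding z_def by eventually_elim (use t in simp)
    have limL: "(\<lambda>x. y u x + t * \<zeta> x) \<in> Lp_inf X r"
      using Lp_inf_lincomb[OF sol_Lp_inf[OF u] \<zeta>, of 1 t] r by simp
    have z_conv: "tendsto_Lp X q z (\<lambda>x. y u x + t * \<zeta> x)" if q: "r \<le> q" for q
    proof (rule tendsto_Lp_dominated[OF _ Lp_inf_measurable[OF zL] Lp_inf_measurable[OF limL]
          Lp_inf_imp_Lp[OF gL q] z_le])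
      show "AE x in X. (\<lambda>n. z n x) \<longlonglongrightarrow> y u x + t * \<zeta> x"
        using inc unfolding z_def by eventually_elim (auto intro!: tendsto_intros)
    qed (use r q in simp)
    have "AE x in X. ereal (T (\<lambda>x. y u x + t * \<zeta> x) ?w x) \<le> limsup (\<lambda>n. ereal (T (z n) ?w x))"
      by (rule semi[unfolded Psi_semicontinuous_def, rule_format, OF wU])
         (use zL norm z_mono z_conv in blast)
    moreover have "AE x in X. \<forall>n. ereal (T_quotient (y u) u (\<zeta>s n) h t x) \<le> DPsi u h (\<zeta>s n) x"
      unfolding AE_all_countable
    proof
      fix n
      have "AE x in X. - \<epsilon> \<le> y u x + t * \<zeta>s n x"
        by (rule ge) (use t between[of n] in \<open>auto elim!: AE_mp\<close>)
      then show "AE x in X. ereal (T_quotient (y u) u (\<zeta>s n) h t x) \<le> DPsi u h (\<zeta>s n) x"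
        by (rule T_quotient_le_Psi_deriv[OF sol_Lp_2[OF u] sol_nonneg[OF u] u L2[OF \<zeta>s] _ t(1) wU h])
    qed
    ultimately show ?thesis using D_lim
    proof eventually_elim
      case (elim x)
      show ?case
      proof (rule field_le_epsilon)
        fix e :: real assume e: "0 < e"
        have "\<forall>\<^sub>F n in sequentially. DPsi u h (\<zeta>s n) x < ereal (\<zeta> x + e)"
          by (rule order_tendstoD(2)[OF elim(3)]) (use e in simp)
        then have "\<forall>\<^sub>F n in sequentially. ereal (T (z n) ?w x) \<le> ereal (T (y u) u x + t * (\<zeta> x + e))"
        proof eventually_elim
          case (elim n)
          then have "ereal (T_quotient (y u) u (\<zeta>s n) h t x) < ereal (\<zeta> x + e)"
            using \<open>\<forall>n. ereal (T_quotient (y u) u (\<zeta>s n) h t x) \<le> DPsi u h (\<zeta>s n) x\<close>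
              order_le_less_trans by blast
          then show ?case using t(1)
            by (simp add: T_quotient_def z_def[abs_def] pos_divide_less_eq algebra_simps)
        qed
        then have "limsup (\<lambda>n. ereal (T (z n) ?w x)) \<le> ereal (T (y u) u x + t * (\<zeta> x + e))"
          by (rule Limsup_bounded)
        then have "ereal (T (\<lambda>x. y u x + t * \<zeta> x) ?w x) \<le> ereal (T (y u) u x + t * (\<zeta> x + e))"
          using elim(1) order_trans by blast
        then show "T_quotient (y u) u \<zeta> h t x \<le> \<zeta> x + e"
          using t(1) by (simp add: T_quotient_def pos_divide_le_eq algebra_simps)
      qed
    qed
  qed
  have upper: "AE x in X. DPsi u h \<zeta> x \<le> ereal (\<zeta> x)"
  proof -
    note \<tau> = null_steps[OF t1(1)]
    have "AE x in X. \<forall>n. T_quotient (y u) u \<zeta> h (t1 / real (Suc (Suc n))) x \<le> \<zeta> x"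
      unfolding AE_all_countable using quotient_le[OF \<tau>(1) less_imp_le[OF \<tau>(2)]] by blast
    then show ?thesis
      using Psi_deriv_limit[OF sol_Lp_2[OF u] sol_nonneg[OF u] u L2[OF \<zeta>] h \<tau>(1,3)]
    proof eventually_elim
      case (elim x)
      show ?case by (rule LIMSEQ_le_const2[OF elim(2)]) (use elim(1) in auto)
    qed
  qed
  have "AE x in X. ereal (\<zeta> x) = DPsi u h \<zeta> x"
    using lower upper by eventually_elim (rule order.antisym)
  then show "\<zeta> \<in> B_set X U S \<Phi> r u h" using \<zeta> by (simp add: B_set_def)
qed

end

theorem theorem5p4:
  fixes X :: "'x measure" and Y :: "'y measure"
    and P :: "'p::real_vector set" and ordP :: "'p option rel"
    and U :: "('y \<Rightarrow> real) set"
    and S :: "'p option \<Rightarrow> ('y \<Rightarrow> real) \<Rightarrow> 'x \<Rightarrow> real"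
    and \<Phi> :: "('x \<Rightarrow> real) \<Rightarrow> 'p"
    and r :: real
  assumes X: "complete_measure X"
    and P_order: "partial_order_on (P_bar P) ordP"
    and P_largest: "\<forall>p\<in>P_bar P. (p, None) \<in> ordP"
    and S_range: "\<forall>p\<in>P_bar P. \<forall>u\<in>U. S p u \<in> nonneg_part X (Lp X 2)"
    and S_well_defined: "\<forall>p\<in>P_bar P. \<forall>u1\<in>U. \<forall>u2\<in>U. eq_ae Y u1 u2 \<longrightarrow> eq_ae X (S p u1) (S p u2)"
    and S_mono: "\<forall>u\<in>U. \<forall>p1\<in>P_bar P. \<forall>p2\<in>P_bar P. (p1, p2) \<in> ordP \<longrightarrow> le_ae X (S p1 u) (S p2 u)"
    and Phi_range: "\<forall>v\<in>Lp X 2. \<Phi> v \<in> P"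
    and Phi_mono: "\<forall>v1\<in>Lp X 2. \<forall>v2\<in>Lp X 2. le_ae X v1 v2 \<longrightarrow> (Some (\<Phi> v1), Some (\<Phi> v2)) \<in> ordP"
    \<comment> \<open>(i)\<close>
    and P_convex: "convex P"
    and P_zero: "0 \<in> P"
    and P_compat: "\<forall>p1\<in>P. \<forall>p2\<in>P. \<forall>l\<in>{0..1::real}.
          (Some (l *\<^sub>R p1), Some (l *\<^sub>R p1 + (1 - l) *\<^sub>R p2)) \<in> ordP"
    \<comment> \<open>(ii)\<close>
    and Y: "complete_measure Y"
    and U_subset: "U \<subseteq> nonneg_part Y (Linf Y)"
    and U_closed_ae: "\<forall>u\<in>U. \<forall>w\<in>borel_measurable Y. eq_ae Y u w \<longrightarrow> w \<in> U"
    and U_convex: "\<forall>u1\<in>U. \<forall>u2\<in>U. \<forall>l\<in>{0..1::real}. (\<lambda>y. l * u1 y + (1 - l) * u2 y) \<in> U"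
    and U_zero: "(\<lambda>y. 0) \<in> U"
    \<comment> \<open>(iii)\<close>
    and S_concave: "\<forall>p1\<in>P. \<forall>p2\<in>P. \<forall>u1\<in>U. \<forall>u2\<in>U. \<forall>l\<in>{0..1::real}.
          le_ae X (\<lambda>x. l * S (Some p1) u1 x + (1 - l) * S (Some p2) u2 x)
                  (S (Some (l *\<^sub>R p1 + (1 - l) *\<^sub>R p2)) (\<lambda>y. l * u1 y + (1 - l) * u2 y))"
    and S_mono_u: "\<forall>p\<in>P. \<forall>u1\<in>U. \<forall>u2\<in>U. le_ae Y u1 u2 \<longrightarrow> le_ae X (S (Some p) u1) (S (Some p) u2)"
    and S_bounded: "\<forall>p\<in>P. \<forall>u\<in>U. S (Some p) u \<in> nonneg_part X (Linf X)"
    \<comment> \<open>(iv)\<close>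
    and Phi_concave: "\<exists>\<epsilon>>0. \<forall>l\<in>{0..1::real}. \<forall>v1\<in>Lp X 2. \<forall>v2\<in>Lp X 2.
          (AE x in X. v1 x \<ge> -\<epsilon>) \<and> (AE x in X. v2 x \<ge> -\<epsilon>) \<longrightarrow>
          (Some (l *\<^sub>R \<Phi> v1 + (1 - l) *\<^sub>R \<Phi> v2), Some (\<Phi> (\<lambda>x. l * v1 x + (1 - l) * v2 x))) \<in> ordP"
    and r: "1 \<le> r" "r \<le> 2"
    and S_Lr: "\<forall>p\<in>P. \<forall>u\<in>U. S (Some p) u \<in> Lp X r"
  shows
    \<comment> \<open>the solution operator and the directional derivative of \<open>\<Psi>\<close> are well defined\<close>
    "(\<forall>u\<in>U. \<exists>y. is_solution X S \<Phi> u y \<and> (\<forall>z. is_solution X S \<Phi> u z \<longrightarrow> eq_ae X z y)) \<and>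
     (\<forall>v\<in>nonneg_part X (Lp X 2). \<forall>u\<in>U. \<forall>h1\<in>Lp_inf X 2. \<forall>h2\<in>cone_at U u.
        \<exists>D. is_Psi_deriv X U S \<Phi> v u h1 h2 D \<and>
            (\<forall>D'. is_Psi_deriv X U S \<Phi> v u h1 h2 D' \<longrightarrow> eq_ae X D' D)) \<and>
     \<comment> \<open>(a)\<close>
     (\<forall>u\<in>U. sol X S \<Phi> u \<in> nonneg_part X (Lp_inf X r)) \<and>
     (\<forall>u\<in>U \<inter> Linf_oplus Y. \<forall>h\<in>cone_at U u.
        \<exists>d. is_hadamard_deriv X Y U r (sol X S \<Phi>) u h d \<and>
            (\<forall>d'. is_hadamard_deriv X Y U r (sol X S \<Phi>) u h d' \<longrightarrow> eq_ae X d' d)) \<and>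
     (\<forall>u\<in>U \<inter> Linf_oplus Y. \<forall>h\<in>cone_at U u. \<forall>\<tau>0>0. (\<lambda>y. u y + \<tau>0 * h y) \<in> U \<longrightarrow>
        \<comment> \<open>(b)\<close>
        (\<forall>\<delta>. is_hadamard_deriv X Y U r (sol X S \<Phi>) u h \<delta> \<longleftrightarrow>
              smallest_ae X (A_set X U S \<Phi> r u h \<tau>0) \<delta>) \<and>
        \<comment> \<open>(c)\<close>
        B_set X U S \<Phi> r u h \<subseteq> A_set X U S \<Phi> r u h \<tau>0 \<and>
        \<comment> \<open>(d)\<close>
        (Psi_semicontinuous X U S \<Phi> r \<longrightarrow>
           A_set X U S \<Phi> r u h \<tau>0 = B_set X U S \<Phi> r u h \<and>
           (\<forall>\<delta>. is_hadamard_deriv X Y U r (sol X S \<Phi>) u h \<delta> \<longrightarrow>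
                 smallest_ae X (B_set X U S \<Phi> r u h) \<delta>)))"
proof -
  obtain e where e: "0 < e" and e_conc: "\<forall>l\<in>{0..1::real}. \<forall>v1\<in>Lp X 2. \<forall>v2\<in>Lp X 2.
      (AE x in X. v1 x \<ge> - e) \<and> (AE x in X. v2 x \<ge> - e) \<longrightarrow>
      (Some (l *\<^sub>R \<Phi> v1 + (1 - l) *\<^sub>R \<Phi> v2), Some (\<Phi> (\<lambda>x. l * v1 x + (1 - l) * v2 x))) \<in> ordP"
    using Phi_concave by blast
  have conc: "(Some (l *\<^sub>R \<Phi> v1 + (1 - l) *\<^sub>R \<Phi> v2), Some (\<Phi> (\<lambda>x. l * v1 x + (1 - l) * v2 x))) \<in> ordP"
    if "0 \<le> l" "l \<le> 1" "v1 \<in> Lp X 2" "v2 \<in> Lp X 2" "AE x in X. - e \<le> v1 x" "AE x in X. - e \<le> v2 x"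
    for l v1 v2
    using e_conc that by simp
  interpret fp: concave_fixed_point X Y U S \<Phi> e r
  proof
    show "u \<in> Linf Y" if "u \<in> U" for u using U_subset that by (auto simp: nonneg_part_def)
    show "AE y in Y. 0 \<le> u y" if "u \<in> U" for u using U_subset that by (auto simp: nonneg_part_def)
    show "(\<lambda>y. l * u1 y + (1 - l) * u2 y) \<in> U" if "u1 \<in> U" "u2 \<in> U" "0 \<le> l" "l \<le> 1" for u1 u2 l
      using U_convex that by simp
    show "Psi S \<Phi> v u \<in> Lp_inf X r" if "v \<in> Lp X 2" "u \<in> U" for v u
      using S_bounded S_Lr Phi_range that by (simp add: Psi_def Lp_inf_def nonneg_part_def)
    show "AE x in X. 0 \<le> Psi S \<Phi> v u x" if "v \<in> Lp X 2" "u \<in> U" for v u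
      using S_bounded Phi_range that by (simp add: Psi_def nonneg_part_def)
    have inP: "Some (\<Phi> v) \<in> P_bar P" if "v \<in> Lp X 2" for v
      using Phi_range that by (simp add: P_bar_def)
    show "le_ae X (Psi S \<Phi> v1 u1) (Psi S \<Phi> v2 u2)"
      if v: "v1 \<in> Lp X 2" "v2 \<in> Lp X 2" and u: "u1 \<in> U" "u2 \<in> U"
        and le: "le_ae X v1 v2" "le_ae Y u1 u2" for v1 v2 u1 u2
    proof -
      have "(Some (\<Phi> v1), Some (\<Phi> v2)) \<in> ordP" using Phi_mono v le(1) by blast
      then have "le_ae X (S (Some (\<Phi> v1)) u1) (S (Some (\<Phi> v2)) u1)"
        using S_mono inP v u by blast
      moreover have "le_ae X (S (Some (\<Phi> v2)) u1) (S (Some (\<Phi> v2)) u2)"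
        using S_mono_u Phi_range v u le(2) by blast
      ultimately show ?thesis unfolding Psi_def by eventually_elim (rule order_trans)
    qed
    show "AE x in X. l * Psi S \<Phi> v1 u1 x + (1 - l) * Psi S \<Phi> v2 u2 x
        \<le> Psi S \<Phi> (\<lambda>x. l * v1 x + (1 - l) * v2 x) (\<lambda>y. l * u1 y + (1 - l) * u2 y) x"
      if v: "v1 \<in> Lp X 2" "v2 \<in> Lp X 2" and u: "u1 \<in> U" "u2 \<in> U" and l: "0 \<le> l" "l \<le> 1"
        and ge: "AE x in X. - e \<le> v1 x" "AE x in X. - e \<le> v2 x" for v1 v2 u1 u2 l
    proof -
      let ?p = "l *\<^sub>R \<Phi> v1 + (1 - l) *\<^sub>R \<Phi> v2" and ?v = "\<lambda>x. l * v1 x + (1 - l) * v2 x"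
        and ?u = "\<lambda>y. l * u1 y + (1 - l) * u2 y"
      have P12: "\<Phi> v1 \<in> P" "\<Phi> v2 \<in> P" using Phi_range v by auto
      have "?p \<in> P" by (rule convexD[OF P_convex P12]) (use l in auto)
      then have p: "Some ?p \<in> P_bar P" by (simp add: P_bar_def)
      have v': "?v \<in> Lp X 2" by (rule Lp_lincomb) (use v in auto)
      have u': "?u \<in> U" using U_convex u l by simp
      have "le_ae X (\<lambda>x. l * S (Some (\<Phi> v1)) u1 x + (1 - l) * S (Some (\<Phi> v2)) u2 x) (S (Some ?p) ?u)"
        using S_concave P12 u l by simp
      moreover have "le_ae X (S (Some ?p) ?u) (S (Some (\<Phi> ?v)) ?u)"
        by (rule S_mono[rule_format, OF u' p inP[OF v'] conc[OF l v ge]])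
      ultimately show ?thesis unfolding Psi_def by eventually_elim (rule order_trans)
    qed
    show "\<exists>b\<in>Lp X 2. \<forall>v\<in>Lp X 2. le_ae X (Psi S \<Phi> v u) b" if "u \<in> U" for u
    proof (intro bexI ballI)
      \<comment> \<open>The largest element of the parameter set provides the bound.\<close>
      have None: "None \<in> P_bar P" by (simp add: P_bar_def)
      show "S None u \<in> Lp X 2" using S_range None that by (auto simp: nonneg_part_def)
      show "le_ae X (Psi S \<Phi> v u) (S None u)" if "v \<in> Lp X 2" for v
        unfolding Psi_def using S_mono P_largest inP[OF that] None \<open>u \<in> U\<close> by blast
    qed
  qed (use r e U_zero in auto)
  have oplus: "\<exists>c>0. AE y in Y. c \<le> u y" if "u \<in> U \<inter> Linf_oplus Y" for u
    using that by (auto simp: Linf_oplus_def)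
  have had_ex: "\<exists>d. is_hadamard_deriv X Y U r (sol X S \<Phi>) u h d \<and>
      (\<forall>d'. is_hadamard_deriv X Y U r (sol X S \<Phi>) u h d' \<longrightarrow> eq_ae X d' d)"
    if uh: "u \<in> U \<inter> Linf_oplus Y" "h \<in> cone_at U u" for u h
  proof -
    have u: "u \<in> U" using uh by simp
    obtain c where c: "0 < c" "AE y in Y. c \<le> u y" using oplus[OF uh(1)] by blast
    obtain d where d: "fp.is_quotient_limit u h d"
      using fp.quotient_limit_exists[OF u c uh(2)] by blast
    show ?thesis
      using fp.quotient_limit_imp_hadamard[OF u c uh(2) d] fp.hadamard_iff[OF u c uh(2) d] by blast
  qed
  have sol_ex: "\<exists>y. is_solution X S \<Phi> u y \<and> (\<forall>z. is_solution X S \<Phi> u z \<longrightarrow> eq_ae X z y)"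
    if "u \<in> U" for u
    using fp.sol_is_solution[OF that] fp.solution_unique[OF that] by blast
  have deriv_ex: "\<exists>D. is_Psi_deriv X U S \<Phi> v u h1 h2 D \<and>
      (\<forall>D'. is_Psi_deriv X U S \<Phi> v u h1 h2 D' \<longrightarrow> eq_ae X D' D)"
    if "v \<in> nonneg_part X (Lp X 2)" "u \<in> U" "h1 \<in> Lp_inf X 2" "h2 \<in> cone_at U u" for v u h1 h2
    using fp.Psi_deriv_exists[of v u h1 h2] that unfolding nonneg_part_def by blast
  have sol_in: "sol X S \<Phi> u \<in> nonneg_part X (Lp_inf X r)" if "u \<in> U" for u
    using fp.sol_Lp_inf[OF that] fp.sol_nonneg[OF that] by (simp add: nonneg_part_def)
  have char: "(\<forall>\<delta>. is_hadamard_deriv X Y U r (sol X S \<Phi>) u h \<delta> \<longleftrightarrow>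
        smallest_ae X (A_set X U S \<Phi> r u h t0) \<delta>) \<and>
      B_set X U S \<Phi> r u h \<subseteq> A_set X U S \<Phi> r u h t0 \<and>
      (Psi_semicontinuous X U S \<Phi> r \<longrightarrow>
        A_set X U S \<Phi> r u h t0 = B_set X U S \<Phi> r u h \<and>
        (\<forall>\<delta>. is_hadamard_deriv X Y U r (sol X S \<Phi>) u h \<delta> \<longrightarrow>
          smallest_ae X (B_set X U S \<Phi> r u h) \<delta>))"
    if uh: "u \<in> U \<inter> Linf_oplus Y" "h \<in> cone_at U u" and t0: "0 < t0" "(\<lambda>y. u y + t0 * h y) \<in> U"
    for u h t0
  proof -
    have u: "u \<in> U" using uh by simp
    obtain c where c: "0 < c" "AE y in Y. c \<le> u y" using oplus[OF uh(1)] by blast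
    note iff = fp.hadamard_iff_smallest[OF u c uh(2) t0]
    note BA = fp.B_set_subset_A_set[OF u uh(2) t0]
    have AB: "A_set X U S \<Phi> r u h t0 = B_set X U S \<Phi> r u h" if "Psi_semicontinuous X U S \<Phi> r"
      using BA fp.A_set_subset_B_set[OF u uh(2) t0 that] by blast
    show ?thesis using iff BA AB by auto
  qed
  show ?thesis using sol_ex deriv_ex sol_in had_ex char by (intro conjI ballI allI impI) blast+
qed

end
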